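(* Let $\nu$ be a probability measure on $[0,1]$ with $\nu(\{0\})=0$, let $\mathbb{B}^{(\nu)}=(\mathbb{B}^{(\nu)}_t)_{t\in[0,1]}$ be the associated generalized Brownian meander, i.e. $\mathbb{B}^{(\nu)}_t=V^{-1/2}\,\mathbb{B}^{ex}_{Vt}$ where $V$ has law $\nu$ and is independent of the Brownian excursion $\mathbb{B}^{ex}$, and let $$\varphi_\nu(x)=\frac{\sqrt{x}\,e^{x/2}}{\sqrt{2\pi}}\int_{(0,1]}e^{-\frac{x}{2v}}\,v^{-3/2}\,\nu(dv),\qquad x>0.$$ Let $(X_t)_{t\ge 0}$ be the Markov process on $[0,\infty)$ with transition densities $$p_t(x,y)=\frac{2t\sqrt{y}}{\pi\left[(y-x)^2+2(x+y)t^2+t^4\right]},\qquad t>0,\ x,y\ge 0,$$ with $\mathbb{E}_x$ denoting expectation when $X_0=x$. Let $d\ge 1$ be an integer, let $s_0=0<s_1<s_2<\dots<s_d$ be real numbers and let $t_0=0\le t_1<t_2<\dots<t_d\le 1=t_{d+1}$. Then $$\mathbb{E}\left[\exp\left(-\sum_{k=1}^d (s_k-s_{k-1})\mathbb{B}^{(\nu)}_{1-t_k}\right)\right]=\int_0^\infty \mathbb{E}_x\left[\exp\left(-\frac12\sum_{k=0}^{d}(t_{k+1}-t_k)X_{s_k}\right)\right]\varphi_\nu(x)\,dx.$$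
   Context: Brownian excursion: $\mathbb{B}^{ex}=(\mathbb{B}^{ex}_t)_{t\in[0,1]}$ is the process (with continuous paths) with $\mathbb{B}^{ex}_0=\mathbb{B}^{ex}_1=0$ whose joint density at times $0<t_1<\dots<t_d<1$ is $$f_{t_1,\dots,t_d}(y_1,\dots,y_d)=\sqrt{8\pi}\,\ell_{t_1}(y_1)\,\ell_{1-t_d}(y_d)\prod_{k=1}^{d-1}g_{t_{k+1}-t_k}(y_k,y_{k+1}),$$ where $$\ell_t(y)=\frac{1}{\sqrt{2\pi t^3}}\,y\,e^{-y^2/(2t)}\mathbf{1}_{\{y>0\}},\qquad g_t(y_1,y_2)=\frac{1}{\sqrt{2\pi t}}\left[e^{-(y_1-y_2)^2/(2t)}-e^{-(y_1+y_2)^2/(2t)}\right]\mathbf{1}_{\{y_1,y_2>0\}}.$$ Process $X$: $(X_t)_{t\ge0}$ is the time-homogeneous Markov process with state space $[0,\infty)$ and transition probabilities $\mathbb{P}(X_t\in dy\mid X_s=x)=p_{t-s}(x,y)\,dy$ for $0\le s<t$, $x\ge 0$, with $p_t(x,y)$ as in the statement. For $x>0$, $\mathbb{E}_x$ is the expectation for the law of $(X_t)_{t\ge 0}$ started at $X_0=x$. *)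

theory Defs
  imports "HOL-Probability.Probability"
begin

definition exc_entrance :: "real \<Rightarrow> real \<Rightarrow> real" where
  "exc_entrance t y = 1 / sqrt (2 * pi * t ^ 3) * y * exp (- y\<^sup>2 / (2 * t)) * indicator {0<..} y"

definition killed_heat_kernel :: "real \<Rightarrow> real \<Rightarrow> real \<Rightarrow> real" where
  "killed_heat_kernel t x y =
     1 / sqrt (2 * pi * t) * (exp (- (x - y)\<^sup>2 / (2 * t)) - exp (- (x + y)\<^sup>2 / (2 * t)))
       * indicator {0<..} x * indicator {0<..} y"

definition excursion_density :: "nat \<Rightarrow> (nat \<Rightarrow> real) \<Rightarrow> (nat \<Rightarrow> real) \<Rightarrow> real" where
  "excursion_density d t y =
     sqrt (8 * pi) * exc_entrance (t 1) (y 1) * exc_entrance (1 - t d) (y d)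
       * (\<Prod>k\<in>{1..<d}. killed_heat_kernel (t (Suc k) - t k) (y k) (y (Suc k)))"

(* B is indexed by all reals, but only its values at times in [0,1] are constrained. *)
locale brownian_excursion = prob_space M
  for M :: "'a measure" and B :: "real \<Rightarrow> 'a \<Rightarrow> real" +
  assumes random_variable_B: "\<And>t. t \<in> {0..1} \<Longrightarrow> random_variable borel (B t)"
    and continuous_paths: "\<And>\<omega>. \<omega> \<in> space M \<Longrightarrow> continuous_on {0..1} (\<lambda>t. B t \<omega>)"
    and B_0: "\<And>\<omega>. \<omega> \<in> space M \<Longrightarrow> B 0 \<omega> = 0"
    and B_1: "\<And>\<omega>. \<omega> \<in> space M \<Longrightarrow> B 1 \<omega> = 0"
    and joint_density: "\<And>(d::nat) t. d \<ge> 1 \<Longrightarrow> 0 < t 1 \<Longrightarrow> t d < 1 \<Longrightarrow>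
          (\<And>k. k \<in> {1..<d} \<Longrightarrow> t k < t (Suc k)) \<Longrightarrow>
          distributed M (\<Pi>\<^sub>M k\<in>{1..d}. lborel) (\<lambda>\<omega>. \<lambda>k\<in>{1..d}. B (t k) \<omega>)
            (\<lambda>y. ennreal (excursion_density d t y))"

(* For V = 0 the value is 0; in the use below this has probability zero. *)
definition generalized_meander ::
    "('a \<Rightarrow> real) \<Rightarrow> (real \<Rightarrow> 'a \<Rightarrow> real) \<Rightarrow> real \<Rightarrow> 'a \<Rightarrow> real" where
  "generalized_meander V B t \<omega> = V \<omega> powr (- 1 / 2) * B (V \<omega> * t) \<omega>"

definition meander_phi :: "real measure \<Rightarrow> real \<Rightarrow> real" where
  "meander_phi \<nu> x = sqrt x * exp (x / 2) / sqrt (2 * pi)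
     * (LINT v:{0<..1}|\<nu>. exp (- x / (2 * v)) * v powr (- 3 / 2))"

definition natural_filtration ::
    "'b measure \<Rightarrow> (real \<Rightarrow> 'b \<Rightarrow> real) \<Rightarrow> real \<Rightarrow> 'b measure" where
  "natural_filtration M X s =
     sigma (space M) {X u -` A \<inter> space M | u A. 0 \<le> u \<and> u \<le> s \<and> A \<in> sets borel}"

(* Time-homogeneous Markov process (X t), t >= 0, on [0,infinity) with transition densities
   p with respect to Lebesgue measure and initial state x, Markov with respect to its
   natural filtration. *)
locale markov_process_from = prob_space M
  for p :: "real \<Rightarrow> real \<Rightarrow> real \<Rightarrow> real"
    and M :: "'b measure" and X :: "real \<Rightarrow> 'b \<Rightarrow> real" and x :: real +
  assumes random_variable_X: "\<And>t. t \<ge> 0 \<Longrightarrow> random_variable borel (X t)"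
    and state_space: "\<And>t \<omega>. t \<ge> 0 \<Longrightarrow> \<omega> \<in> space M \<Longrightarrow> X t \<omega> \<in> {0..}"
    and initial_state: "AE \<omega> in M. X 0 \<omega> = x"
    and markov: "\<And>s t A. 0 \<le> s \<Longrightarrow> s < t \<Longrightarrow> A \<in> sets borel \<Longrightarrow> A \<subseteq> {0..} \<Longrightarrow>
          AE \<omega> in M. real_cond_exp M (natural_filtration M X s) (\<lambda>\<omega>. indicator A (X t \<omega>)) \<omega>
                     = (LINT y:A|lborel. p (t - s) (X s \<omega>) y)"

definition trans_density :: "real \<Rightarrow> real \<Rightarrow> real \<Rightarrow> real" where
  "trans_density t x y =
     2 * t * sqrt y / (pi * ((y - x)\<^sup>2 + 2 * (x + y) * t\<^sup>2 + t ^ 4))"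

end

theory Submission
  imports Defs "HOL-Real_Asymp.Real_Asymp"
begin

text \<open>
  Both sides are the same iterated integral, seen from two dual families of variables. The kernels
  of the Brownian excursion are diagonalised by sine functions: for \<open>z, w > 0\<close>,

  \<open>exc_entrance \<tau> z = 1/(2\<pi>) \<integral> sin(\<surd>x z) exp(-\<tau> x/2) dx\<close> and
  \<open>killed_heat_kernel \<tau> w z = \<integral> sin(\<surd>x w) sin(\<surd>x z) exp(-\<tau> x/2) / (\<pi> \<surd>x) dx\<close>,

  with \<open>x\<close> running over the half-line (\<open>exc_entrance_spectral\<close>, \<open>killed_heat_kernel_spectral\<close>). In
  the Laplace functional of the excursion every factor of the joint density therefore contributes
  one spectral variable, and the value \<open>w\<close> of the path at one of its times occurs only in
  \<open>exp(-c w)\<close> times two sines. That integral over \<open>w\<close> is elementary and is, up to the factor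
  \<open>\<pi> \<surd>x\<close>, the transition density of the process \<open>X\<close> at time \<open>c\<close>
  (\<open>half_line_laplace_sin_sin\<close>). So the spectral variables form a path of \<open>X\<close>: the coefficients of
  the Laplace functional turn into time steps of \<open>X\<close>, and the time steps of the excursion turn into
  exponential weights.

  This exchange of variables is made one time point after the other. The lemma
  \<open>sine_transform_parseval\<close> is one step; induction on the number of time points
  (\<open>nn_integral_killed_paths\<close>) leads to \<open>excursion_laplace_transform\<close>. What appears there is
  the backward recursion \<open>feynman_kac\<close>, and \<open>feynman_kac_formula\<close> recognises it as the expectation
  of the exponential functional of \<open>X\<close> by means of the Markov property.

  For a fixed length \<open>V = v\<close> the meander is a rescaled excursion. The scale invariance of
  the recursion (\<open>feynman_kac_scale\<close>) moves the dependence on \<open>v\<close> into one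
  spectral factor (\<open>rescaled_excursion_laplace\<close>), whose average over \<open>\<nu>\<close> is \<open>meander_phi \<nu>\<close>. The
  degenerate times need separate arguments. For \<open>t d = 1\<close> the last time contributes nothing
  on either side and is dropped. For \<open>v = 1\<close> and \<open>t 1 = 0\<close> the excursion is evaluated at its right
  end, where it has no density, and the formula follows from that for \<open>v < 1\<close> by continuity of the
  paths.

  After the sine integrals have been evaluated every quantity is nonnegative, so extended
  nonnegative integrals are used from there on.
\<close>


lemma increasing_on_interval_le:
  fixes f :: "nat \<Rightarrow> real"
  assumes "\<And>k. k \<in> {a..<b} \<Longrightarrow> f k \<le> f (Suc k)" "i \<le> j" "a \<le> i" "j \<le> b"
  shows "f i \<le> f j"
  using assms(2,1,3,4)
proof (induction j rule: dec_induct)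
  case (step m)
  then have "f i \<le> f m" "f m \<le> f (Suc m)" by auto
  then show ?case by simp
qed simp

section \<open>Integration over the half-line\<close>

text \<open>Lebesgue measure on the positive reals is encoded as a density with respect to Lebesgue measure
  on the whole line, so that it has the same measurable sets as \<open>borel\<close>.\<close>

definition half_line :: "real measure" where
  "half_line = density lborel (indicator {0<..})"

lemma space_half_line [simp]: "space half_line = UNIV"
  and sets_half_line [measurable_cong, simp]: "sets half_line = sets borel"
  by (simp_all add: half_line_def)

lemma measurable_half_line [simp]:
  "measurable half_line N = measurable borel N" "measurable N half_line = measurable N borel"
  by (rule measurable_cong_sets; simp)+

interpretation half_line: sigma_finite_measure half_line
  unfolding half_line_def
  by (subst sigma_finite_measure.sigma_finite_iff_density_finite[OF lborel.sigma_finite_measure_axioms]) (auto simp: indicator_def)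

interpretation half_line_pair: pair_sigma_finite half_line half_line ..

lemma AE_half_line: "(AE x in half_line. P x) \<longleftrightarrow> (AE x in lborel. 0 < x \<longrightarrow> P x)"
  unfolding half_line_def
  by (subst AE_density) (auto simp: indicator_def intro!: AE_cong)

lemma AE_half_lineI: "(\<And>x. 0 < x \<Longrightarrow> P x) \<Longrightarrow> AE x in half_line. P x"
  by (simp add: AE_half_line)

lemma nn_integral_half_line:
  "f \<in> borel_measurable borel \<Longrightarrow>
    (\<integral>\<^sup>+x. f x \<partial>half_line) = (\<integral>\<^sup>+x. indicator {0<..} x * f x \<partial>lborel)"
  unfolding half_line_def by (subst nn_integral_density) auto

lemma density_half_line_real: "half_line = density lborel (\<lambda>x. ennreal (indicator {0<..} x))"
  unfolding half_line_def by (simp add: ennreal_indicator)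

lemma set_lebesgue_integral_half_line:
  fixes f :: "real \<Rightarrow> real"
  assumes [measurable]: "f \<in> borel_measurable borel"
  shows "(LINT x:{0<..}|lborel. f x) = (\<integral>x. f x \<partial>half_line)"
  unfolding density_half_line_real set_lebesgue_integral_def
  by (subst integral_density) auto

lemma set_integrable_half_line:
  fixes f :: "real \<Rightarrow> real"
  assumes [measurable]: "f \<in> borel_measurable borel"
  shows "set_integrable lborel {0<..} f \<longleftrightarrow> integrable half_line f"
  unfolding density_half_line_real set_integrable_def
  by (subst integrable_density) auto

lemma nn_integral_half_line_cong:
  "(\<And>x. 0 < x \<Longrightarrow> f x = g x) \<Longrightarrow> (\<integral>\<^sup>+x. f x \<partial>half_line) = (\<integral>\<^sup>+x. g x \<partial>half_line)"
  by (intro nn_integral_cong_AE AE_half_lineI)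

lemma integral_half_line_cong:
  fixes f g :: "real \<Rightarrow> real"
  assumes "\<And>x. 0 < x \<Longrightarrow> f x = g x" "f \<in> borel_measurable borel" "g \<in> borel_measurable borel"
  shows "(\<integral>x. f x \<partial>half_line) = (\<integral>x. g x \<partial>half_line)"
  using assms by (intro integral_cong_AE AE_half_lineI) auto

lemma nn_integral_half_line_scale:
  fixes f :: "real \<Rightarrow> ennreal"
  assumes [measurable]: "f \<in> borel_measurable borel" and "0 < c"
  shows "(\<integral>\<^sup>+x. f x \<partial>half_line) = ennreal c * (\<integral>\<^sup>+x. f (c * x) \<partial>half_line)"
proof -
  have "indicator {0<..} (c * x) = (indicator {0<..} x :: ennreal)" for x
    using \<open>0 < c\<close> by (auto simp: indicator_def zero_less_mult_iff)
  then show ?thesis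
    using \<open>0 < c\<close>
    by (simp add: nn_integral_half_line
          nn_integral_real_affine[of "\<lambda>x. indicator {0<..} x * f x" c 0])
qed

lemma half_line_integral_scale:
  fixes f :: "real \<Rightarrow> real"
  assumes [measurable]: "f \<in> borel_measurable borel" and "0 < c"
  shows "(\<integral>x. f x \<partial>half_line) = c * (\<integral>x. f (c * x) \<partial>half_line)"
proof -
  have "indicator {0<..} (c * x) = (indicator {0<..} x :: real)" for x
    using \<open>0 < c\<close> by (auto simp: indicator_def zero_less_mult_iff)
  then show ?thesis
    using \<open>0 < c\<close> lborel_integral_real_affine[of c "\<lambda>x. indicator {0<..} x *\<^sub>R f x" 0]
    by (simp add: set_lebesgue_integral_half_line[symmetric] set_lebesgue_integral_def)
qed

lemma half_line_integral_FTC: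
  fixes f F :: "real \<Rightarrow> real"
  assumes F: "\<And>x. 0 < x \<Longrightarrow> (F has_real_derivative f x) (at x)"
    and f: "\<And>x. 0 < x \<Longrightarrow> isCont f x"
    and int: "integrable half_line f" and [measurable]: "f \<in> borel_measurable borel"
    and A: "(F \<longlongrightarrow> A) (at_right 0)" and B: "(F \<longlongrightarrow> B) at_top"
  shows "(\<integral>x. f x \<partial>half_line) = B - A"
proof -
  have "(LBINT x=0..\<infinity>. f x) = B - A"
  proof (rule interval_integral_FTC_integrable)
    show "set_integrable lborel (einterval 0 \<infinity>) f"
      using int by (simp add: set_integrable_half_line[symmetric] zero_ereal_def)
    show "((F \<circ> real_of_ereal) \<longlongrightarrow> A) (at_right 0)"
      using A by (simp add: ereal_tendsto_simps1 zero_ereal_def)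
    show "((F \<circ> real_of_ereal) \<longlongrightarrow> B) (at_left \<infinity>)"
      using B by (simp add: ereal_tendsto_simps1)
  qed (use F f in \<open>auto simp: has_real_derivative_iff_has_vector_derivative[symmetric]\<close>)
  then show ?thesis
    by (simp add: interval_lebesgue_integral_0_infty set_lebesgue_integral_half_line)
qed

section \<open>Elementary Laplace and Fourier integrals\<close>

lemma half_line_integral_exp:
  assumes "0 < c"
  shows "integrable half_line (\<lambda>x. exp (- c * x))"
    and "(\<integral>x. exp (- c * x) \<partial>half_line) = 1 / c"
proof -
  have 1: "(\<integral>\<^sup>+x. ennreal (exp (- c * x)) \<partial>half_line) = ennreal (0 - (- exp (- c * 0) / c))"
  proof -
    have "(\<integral>\<^sup>+x. ennreal (exp (- c * x)) \<partial>half_line)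
        = (\<integral>\<^sup>+x. ennreal (exp (- c * x)) * indicator {0..} x \<partial>lborel)"
      using AE_lborel_singleton[of 0]
      by (subst nn_integral_half_line) (auto intro!: nn_integral_cong_AE simp: indicator_def)
    also have "\<dots> = ennreal (0 - (- exp (- c * 0) / c))"
    proof (rule nn_integral_FTC_atLeast)
      show "((\<lambda>x. - exp (- c * x) / c) \<longlongrightarrow> 0) at_top"
        using assms by real_asymp
    qed (use assms in \<open>auto intro!: derivative_eq_intros\<close>)
    finally show ?thesis .
  qed
  show "integrable half_line (\<lambda>x. exp (- c * x))"
    by (rule integrableI_nonneg) (use 1 in auto)
  show "(\<integral>x. exp (- c * x) \<partial>half_line) = 1 / c"
    by (subst integral_eq_nn_integral) (use 1 assms in auto)
qed

text \<open>The antiderivative \<open>exp(-c w) (a sin(a w) - c cos(a w)) / (c\<^sup>2 + a\<^sup>2)\<close> vanishes at infinity.\<close>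

lemma half_line_laplace_cos:
  assumes "0 < c"
  shows "integrable half_line (\<lambda>w. exp (- c * w) * cos (a * w))"
    and "(\<integral>w. exp (- c * w) * cos (a * w) \<partial>half_line) = c / (c\<^sup>2 + a\<^sup>2)"
proof -
  show int: "integrable half_line (\<lambda>w. exp (- c * w) * cos (a * w))"
    by (rule Bochner_Integration.integrable_bound[OF half_line_integral_exp(1)[OF assms]])
       (auto simp: abs_mult)
  have nz: "c\<^sup>2 + a\<^sup>2 \<noteq> 0" using assms by (simp add: sum_power2_eq_zero_iff)
  let ?F = "\<lambda>w. exp (- c * w) * (a * sin (a * w) - c * cos (a * w)) / (c\<^sup>2 + a\<^sup>2)"
  have "(\<integral>w. exp (- c * w) * cos (a * w) \<partial>half_line) = 0 - ?F 0"
  proof (rule half_line_integral_FTC[where F = ?F])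
    show "(?F has_real_derivative exp (- c * x) * cos (a * x)) (at x)" for x
    proof -
      have "((\<lambda>w. exp (- c * w) * (a * sin (a * w) - c * cos (a * w))) has_real_derivative
          exp (- c * x) * cos (a * x) * (c\<^sup>2 + a\<^sup>2)) (at x)"
        by (auto intro!: derivative_eq_intros simp: algebra_simps power2_eq_square)
      from DERIV_cdivide[OF this, of "c\<^sup>2 + a\<^sup>2"] show ?thesis
        by (simp only: nonzero_mult_div_cancel_right[OF nz])
    qed
    show "(?F \<longlongrightarrow> ?F 0) (at_right 0)"
      by (intro tendsto_intros nz)
    show "(?F \<longlongrightarrow> 0) at_top"
    proof (rule Lim_null_comparison)
      show "\<forall>\<^sub>F w in at_top. norm (?F w) \<le> exp (- c * w) * (\<bar>a\<bar> + c) / (c\<^sup>2 + a\<^sup>2)"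
      proof (rule always_eventually, rule allI)
        fix w
        have "\<bar>a * sin (a * w) - c * cos (a * w)\<bar> \<le> \<bar>a\<bar> * 1 + \<bar>c\<bar> * 1"
          by (rule order_trans[OF abs_triangle_ineq4])
             (auto simp: abs_mult intro!: add_mono mult_left_le)
        then show "norm (?F w) \<le> exp (- c * w) * (\<bar>a\<bar> + c) / (c\<^sup>2 + a\<^sup>2)"
          using assms by (auto simp: abs_mult intro!: divide_right_mono mult_left_mono)
      qed
      show "((\<lambda>w. exp (- c * w) * (\<bar>a\<bar> + c) / (c\<^sup>2 + a\<^sup>2)) \<longlongrightarrow> 0) at_top"
        using assms by real_asymp
    qed
  qed (use int in \<open>auto intro!: continuous_intros\<close>)
  then show "(\<integral>w. exp (- c * w) * cos (a * w) \<partial>half_line) = c / (c\<^sup>2 + a\<^sup>2)"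
    by simp
qed

text \<open>This identity is where the transition density of \<open>X\<close> comes from. The product of sines is a
  difference of cosines with frequencies \<open>\<surd>x - \<surd>y\<close> and \<open>\<surd>x + \<surd>y\<close>, and the product of the two
  resulting denominators \<open>c\<^sup>2 + (\<surd>x \<plusminus> \<surd>y)\<^sup>2\<close> is the denominator of
  \<open>trans_density\<close>, up to the factor \<open>\<pi>\<close>.\<close>

lemma half_line_laplace_sin_sin:
  assumes "0 < c" "0 < x" "0 < y"
  shows "(\<integral>w. exp (- c * w) * (sin (sqrt x * w) * sin (sqrt y * w)) \<partial>half_line)
    = pi * sqrt x * trans_density c x y"
proof -
  let ?m = "(sqrt x - sqrt y)" and ?p = "(sqrt x + sqrt y)"
  have "(\<integral>w. exp (- c * w) * (sin (sqrt x * w) * sin (sqrt y * w)) \<partial>half_line)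
      = (\<integral>w. (exp (- c * w) * cos (?m * w) - exp (- c * w) * cos (?p * w)) / 2 \<partial>half_line)"
    by (simp add: sin_times_sin algebra_simps)
  also have "\<dots> = (c / (c\<^sup>2 + ?m\<^sup>2) - c / (c\<^sup>2 + ?p\<^sup>2)) / 2"
    using half_line_laplace_cos[OF assms(1)] by simp
  also have "\<dots> = 2 * c * sqrt x * sqrt y / ((c\<^sup>2 + ?m\<^sup>2) * (c\<^sup>2 + ?p\<^sup>2))"
  proof -
    have "c\<^sup>2 + ?m\<^sup>2 \<noteq> 0" "c\<^sup>2 + ?p\<^sup>2 \<noteq> 0" using assms by (auto simp: sum_power2_eq_zero_iff)
    then show ?thesis by (simp add: divide_simps) (simp add: power2_eq_square algebra_simps)
  qed
  also have "(c\<^sup>2 + ?m\<^sup>2) * (c\<^sup>2 + ?p\<^sup>2) = (y - x)\<^sup>2 + 2 * (x + y) * c\<^sup>2 + c ^ 4"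
  proof -
    have "x = sqrt x ^ 2" "y = sqrt y ^ 2" using assms by auto
    then obtain a b where "x = a^2" "y = b^2" "sqrt x = a" "sqrt y = b" by metis
    then show ?thesis by algebra
  qed
  finally show ?thesis by (simp add: trans_density_def)
qed

text \<open>The spectral variable \<open>x\<close> is the square of a frequency \<open>l\<close>; the Gaussian integrals below are
  computed in \<open>l\<close>.\<close>

lemma half_line_substitution_square:
  fixes f :: "real \<Rightarrow> real"
  assumes [measurable]: "f \<in> borel_measurable borel"
    and int: "integrable half_line (\<lambda>l. 2 * l * f (l\<^sup>2))"
  shows "integrable half_line f"
    and "(\<integral>x. f x \<partial>half_line) = (\<integral>l. 2 * l * f (l\<^sup>2) \<partial>half_line)"
proof -
  have img: "(\<lambda>l::real. l\<^sup>2) ` {0<..} = {0<..}"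
  proof safe
    fix x :: real assume "0 < x"
    then have "x = (sqrt x)\<^sup>2" "sqrt x \<in> {0<..}" by auto
    then show "x \<in> (\<lambda>l::real. l\<^sup>2) ` {0<..}" by blast
  qed auto
  have int': "set_integrable lborel {0<..} (\<lambda>l. 2 * l * f (l\<^sup>2))"
    using int by (subst set_integrable_half_line) auto
  have eq: "\<bar>2 * l\<bar> * f (l\<^sup>2) = 2 * l * f (l\<^sup>2)" if "l \<in> {0<..}" for l
    using that by auto
  have "(\<lambda>l. 2 * l * f (l\<^sup>2)) absolutely_integrable_on {0<..}"
    using int' unfolding set_integrable_def by (subst integrable_completion) auto
  then have "(\<lambda>l. \<bar>2 * l\<bar> * f (l\<^sup>2)) absolutely_integrable_on {0<..}"
    by (subst set_integrable_cong[OF refl refl eq]) auto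
  moreover have "integral {0<..} (\<lambda>l. \<bar>2 * l\<bar> * f (l\<^sup>2)) = integral {0<..} (\<lambda>l. 2 * l * f (l\<^sup>2))"
    by (intro integral_cong eq)
  moreover have "((\<lambda>l. l\<^sup>2) has_real_derivative 2 * l) (at l within {0<..})" for l :: real
    by (auto intro!: derivative_eq_intros)
  moreover have "inj_on (\<lambda>l::real. l\<^sup>2) {0<..}"
    by (auto intro!: inj_onI simp: power2_eq_iff_nonneg)
  ultimately have *: "f absolutely_integrable_on {0<..} \<and>
      integral {0<..} f = integral {0<..} (\<lambda>l. 2 * l * f (l\<^sup>2))"
    using has_absolute_integral_change_of_variables_1'[of "{0<..}" "\<lambda>l. l\<^sup>2" "\<lambda>l. 2 * l" f
        "integral {0<..} (\<lambda>l. 2 * l * f (l\<^sup>2))"]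
    unfolding img by auto
  then have int_f: "set_integrable lborel {0<..} f"
    unfolding set_integrable_def by (subst (asm) integrable_completion) auto
  then show "integrable half_line f" by (simp add: set_integrable_half_line)
  show "(\<integral>x. f x \<partial>half_line) = (\<integral>l. 2 * l * f (l\<^sup>2) \<partial>half_line)"
    using * set_borel_integral_eq_integral(2)[OF int_f] set_borel_integral_eq_integral(2)[OF int']
    by (simp add: set_lebesgue_integral_half_line)
qed

lemma half_line_first_moment_gaussian:
  assumes "0 < \<tau>"
  shows "integrable half_line (\<lambda>l. l * exp (- \<tau> * l\<^sup>2 / 2))"
proof -
  have "(\<integral>\<^sup>+l. ennreal (l * exp (- \<tau> * l\<^sup>2 / 2)) \<partial>half_line)
      = (\<integral>\<^sup>+l. ennreal (l * exp (- \<tau> * l\<^sup>2 / 2)) * indicator {0..} l \<partial>lborel)"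
    using AE_lborel_singleton[of 0]
    by (subst nn_integral_half_line) (auto intro!: nn_integral_cong_AE simp: indicator_def)
  also have "\<dots> = ennreal (0 - (- exp (- \<tau> * 0\<^sup>2 / 2) / \<tau>))"
  proof (rule nn_integral_FTC_atLeast)
    show "((\<lambda>l. - exp (- \<tau> * l\<^sup>2 / 2) / \<tau>) \<longlongrightarrow> 0) at_top"
      using assms by real_asymp
  qed (use assms in \<open>auto intro!: derivative_eq_intros simp: power2_eq_square\<close>)
  finally show ?thesis
    by (intro integrableI_nonneg AE_half_lineI) auto
qed

text \<open>The integral over the whole line is the characteristic function of the standard normal
  distribution, up to scaling, and the integrand is even.\<close>

lemma half_line_fourier_gaussian:
  assumes "0 < \<tau>"
  shows "integrable half_line (\<lambda>l. exp (- \<tau> * l\<^sup>2 / 2) * cos (a * l))"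
    and "(\<integral>l. exp (- \<tau> * l\<^sup>2 / 2) * cos (a * l) \<partial>half_line)
      = sqrt (pi / (2 * \<tau>)) * exp (- a\<^sup>2 / (2 * \<tau>))"
proof -
  let ?f = "\<lambda>l. exp (- \<tau> * l\<^sup>2 / 2) * cos (a * l)"
  let ?g = "\<lambda>u. std_normal_density u * cos ((a / sqrt \<tau>) * u)"
  interpret N: prob_space std_normal_distribution by (rule prob_space_normal_density) simp
  have int_iexp: "integrable std_normal_distribution (\<lambda>x. iexp (t * x))" for t
    by (rule N.integrable_const_bound[where B = 1]) auto
  have char_eq: "(\<integral>u. std_normal_density u * cos (t * u) \<partial>lborel) = exp (- t\<^sup>2 / 2)" for t
  proof -
    have "exp (- t\<^sup>2 / 2) = Re (char std_normal_distribution t)"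
      by (simp add: char_std_normal_distribution del: Re_complex_of_real) simp
    also have "\<dots> = (\<integral>u. Re (iexp (t * u)) \<partial>std_normal_distribution)"
      unfolding char_def by (rule integral_Re[symmetric, OF int_iexp])
    also have "\<dots> = (\<integral>u. cos (t * u) \<partial>std_normal_distribution)"
      by (simp add: Re_exp)
    also have "\<dots> = (\<integral>u. std_normal_density u * cos (t * u) \<partial>lborel)"
      by (subst integral_density) auto
    finally show ?thesis by simp
  qed
  have int_g: "integrable lborel ?g"
    by (rule Bochner_Integration.integrable_bound[OF integrable_normal_density[of 1 0]])
       (auto simp: abs_mult intro!: mult_left_le)
  have f_g: "?f l = sqrt (2 * pi) * ?g (0 + sqrt \<tau> * l)" for l
    using assms by (simp add: normal_density_def power_mult_distrib)
  have "integrable lborel (\<lambda>l. ?g (0 + sqrt \<tau> * l))"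
    using assms by (intro lborel_integrable_real_affine[OF int_g]) auto
  then have int_f: "integrable lborel ?f"
    unfolding f_g by simp
  have "(\<integral>l. ?f l \<partial>lborel) = sqrt (2 * pi) * (\<integral>l. ?g (0 + sqrt \<tau> * l) \<partial>lborel)"
    unfolding f_g by simp
  also have "(\<integral>l. ?g (0 + sqrt \<tau> * l) \<partial>lborel) = (\<integral>u. ?g u \<partial>lborel) / sqrt \<tau>"
    using assms by (subst (2) lborel_integral_real_affine[of "sqrt \<tau>" _ 0]) auto
  also have "(\<integral>u. ?g u \<partial>lborel) = exp (- a\<^sup>2 / (2 * \<tau>))"
    using assms by (subst char_eq) (simp add: power_divide)
  finally have full: "(\<integral>l. ?f l \<partial>lborel) = sqrt (2 * pi) * (exp (- a\<^sup>2 / (2 * \<tau>)) / sqrt \<tau>)" .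
  have int_half: "set_integrable lborel {0<..} ?f"
    unfolding set_integrable_def using int_f by (intro integrable_mult_indicator) auto
  then show "integrable half_line ?f"
    by (subst (asm) set_integrable_half_line) auto
  let ?J = "\<integral>l. ?f l \<partial>half_line"
  have "has_bochner_integral lborel (\<lambda>l. indicator {0..} l *\<^sub>R ?f l) ?J"
  proof -
    have "has_bochner_integral lborel (\<lambda>l. indicator {0<..} l *\<^sub>R ?f l) ?J"
      using int_half set_lebesgue_integral_half_line[of ?f]
      unfolding set_integrable_def set_lebesgue_integral_def has_bochner_integral_iff by auto
    then show ?thesis
      using AE_lborel_singleton[of 0]
      by (subst has_bochner_integral_cong_AE[of _ _ "\<lambda>l. indicator {0<..} l *\<^sub>R ?f l"])
         (auto simp: indicator_def)
  qed
  from has_bochner_integral_even_function[OF this]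
  have "has_bochner_integral lborel ?f (2 * ?J)"
    by simp
  then have "2 * ?J = sqrt (2 * pi) * (exp (- a\<^sup>2 / (2 * \<tau>)) / sqrt \<tau>)"
    using full by (simp add: has_bochner_integral_iff)
  moreover have "sqrt (2 * pi) / sqrt \<tau> = 2 * sqrt (pi / (2 * \<tau>))"
  proof -
    have "sqrt (2 * pi) / sqrt \<tau> = sqrt (4 * (pi / (2 * \<tau>)))"
      by (simp add: real_sqrt_divide[symmetric])
    then show ?thesis unfolding real_sqrt_mult[of 4] by simp
  qed
  ultimately have "2 * ?J = 2 * sqrt (pi / (2 * \<tau>)) * exp (- a\<^sup>2 / (2 * \<tau>))"
    by (metis times_divide_eq_left times_divide_eq_right)
  then show "?J = sqrt (pi / (2 * \<tau>)) * exp (- a\<^sup>2 / (2 * \<tau>))"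
    by simp
qed

text \<open>Integration by parts: \<open>exp(-\<tau> l\<^sup>2 / 2) sin(a l)\<close> vanishes at both ends of the half-line, so the
  integral of its derivative is zero, and that derivative combines the integrand here with the
  cosine integral of \<open>half_line_fourier_gaussian\<close>.\<close>

lemma half_line_fourier_gaussian_moment:
  assumes "0 < \<tau>"
  shows "integrable half_line (\<lambda>l. l * exp (- \<tau> * l\<^sup>2 / 2) * sin (a * l))"
    and "(\<integral>l. l * exp (- \<tau> * l\<^sup>2 / 2) * sin (a * l) \<partial>half_line)
      = a / \<tau> * (sqrt (pi / (2 * \<tau>)) * exp (- a\<^sup>2 / (2 * \<tau>)))"
proof -
  let ?s = "\<lambda>l. l * exp (- \<tau> * l\<^sup>2 / 2) * sin (a * l)"
  let ?c = "\<lambda>l. exp (- \<tau> * l\<^sup>2 / 2) * cos (a * l)"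
  let ?F = "\<lambda>l. - (exp (- \<tau> * l\<^sup>2 / 2) * sin (a * l) / \<tau>)"
  show int_s: "integrable half_line ?s"
    by (rule Bochner_Integration.integrable_bound[OF half_line_first_moment_gaussian[OF assms]])
       (auto simp: abs_mult intro!: mult_left_le AE_half_lineI)
  note int_c = half_line_fourier_gaussian(1)[OF assms, of a]
  have "(\<integral>l. ?s l - a / \<tau> * ?c l \<partial>half_line) = 0 - ?F 0"
  proof (rule half_line_integral_FTC)
    show "(?F has_real_derivative ?s l - a / \<tau> * ?c l) (at l)" for l
      using assms by (auto intro!: derivative_eq_intros simp: field_simps power2_eq_square)
    show "(?F \<longlongrightarrow> ?F 0) (at_right 0)"
      by (intro isCont_tendsto_compose[of _ ?F] tendsto_ident_at) (use assms in auto)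
    show "(?F \<longlongrightarrow> 0) at_top"
    proof (rule Lim_null_comparison)
      show "\<forall>\<^sub>F l in at_top. norm (?F l) \<le> exp (- \<tau> * l\<^sup>2 / 2) / \<tau>"
        using assms by (intro always_eventually) (auto simp: abs_mult intro!: divide_right_mono mult_left_le)
      show "((\<lambda>l. exp (- \<tau> * l\<^sup>2 / 2) / \<tau>) \<longlongrightarrow> 0) at_top"
        using assms by real_asymp
    qed
  qed (use assms int_s int_c in \<open>auto intro!: continuous_intros\<close>)
  then show "(\<integral>l. ?s l \<partial>half_line) = a / \<tau> * (sqrt (pi / (2 * \<tau>)) * exp (- a\<^sup>2 / (2 * \<tau>)))"
    using int_s int_c unfolding half_line_fourier_gaussian(2)[OF assms, symmetric] by simp
qed

text \<open>This is \<open>\<Gamma>(3/2) = \<surd>\<pi> / 2\<close> after scaling. It gives integrability of \<open>\<surd>x exp(-a x)\<close>, and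
  it is also the total mass of the spectral weight when no time points are present.\<close>

lemma half_line_gamma_three_halves:
  assumes "0 < a"
  shows "(\<integral>\<^sup>+x. ennreal (sqrt x * exp (- a * x)) \<partial>half_line) = ennreal (sqrt pi / (2 * a * sqrt a))"
proof -
  have "(\<integral>\<^sup>+x. ennreal (sqrt x * exp (- x)) \<partial>half_line)
      = (\<integral>\<^sup>+x. ennreal (indicator {0..} x * (x powr (3 / 2 - 1) / exp x)) \<partial>lborel)"
  proof (subst nn_integral_half_line)
    show "(\<integral>\<^sup>+x. indicator {0<..} x * ennreal (sqrt x * exp (- x)) \<partial>lborel)
        = (\<integral>\<^sup>+x. ennreal (indicator {0..} x * (x powr (3 / 2 - 1) / exp x)) \<partial>lborel)"
    proof (rule nn_integral_cong)
      fix x :: real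
      show "indicator {0<..} x * ennreal (sqrt x * exp (- x))
          = ennreal (indicator {0..} x * (x powr (3 / 2 - 1) / exp x))"
        by (cases "0 < x") (simp_all add: indicator_def powr_half_sqrt exp_minus inverse_eq_divide)
    qed
  qed simp
  also have "\<dots> = ennreal (Gamma (3 / 2))"
    by (rule nn_integral_has_integral_lebesgue) (use Gamma_integral_real[of "3 / 2"] in auto)
  also have "Gamma (3 / 2 :: real) = sqrt pi / 2"
    using Gamma_plus1[of "1 / 2 :: real"] nonpos_Ints_nonpos[of "1 / 2 :: real"]
    by (auto simp: Gamma_one_half_real)
  finally have base: "(\<integral>\<^sup>+x. ennreal (sqrt x * exp (- x)) \<partial>half_line) = ennreal (sqrt pi / 2)" .
  have "(\<integral>\<^sup>+x. ennreal (sqrt x * exp (- a * x)) \<partial>half_line)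
      = (\<integral>\<^sup>+x. ennreal (1 / sqrt a) * ennreal (sqrt (a * x) * exp (- (a * x))) \<partial>half_line)"
    using assms by (intro nn_integral_cong) (simp add: real_sqrt_mult flip: ennreal_mult')
  also have "\<dots> = ennreal (1 / sqrt a) * (\<integral>\<^sup>+x. ennreal (sqrt (a * x) * exp (- (a * x))) \<partial>half_line)"
    by (rule nn_integral_cmult) simp
  also have "(\<integral>\<^sup>+x. ennreal (sqrt (a * x) * exp (- (a * x))) \<partial>half_line) = ennreal (1 / a) * ennreal (sqrt pi / 2)"
  proof -
    have "ennreal (1 / a) * (\<integral>\<^sup>+x. ennreal (sqrt x * exp (- x)) \<partial>half_line)
        = ennreal (1 / a) * (ennreal a * (\<integral>\<^sup>+x. ennreal (sqrt (a * x) * exp (- (a * x))) \<partial>half_line))"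
      using assms by (subst nn_integral_half_line_scale[of _ a]) auto
    then show ?thesis
      using assms by (simp add: base mult.assoc[symmetric] flip: ennreal_mult')
  qed
  also have "ennreal (1 / sqrt a) * (ennreal (1 / a) * ennreal (sqrt pi / 2)) = ennreal (sqrt pi / (2 * a * sqrt a))"
    using assms by (simp add: field_simps flip: ennreal_mult')
  finally show ?thesis .
qed

section \<open>Spectral representation of the excursion kernels\<close>

lemma exc_entrance_spectral:
  assumes "0 < \<tau>" "0 < z"
  shows "(\<integral>x. sin (sqrt x * z) * (exp (- \<tau> * x / 2) / (2 * pi)) \<partial>half_line) = exc_entrance \<tau> z"
proof -
  let ?f = "\<lambda>x. sin (sqrt x * z) * (exp (- \<tau> * x / 2) / (2 * pi))"
  let ?s = "\<lambda>l. l * exp (- \<tau> * l\<^sup>2 / 2) * sin (z * l)"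
  have eq: "2 * l * ?f (l\<^sup>2) = 1 / pi * ?s l" if "0 < l" for l
    using that by (simp add: ac_simps)
  have int: "integrable half_line (\<lambda>l. 2 * l * ?f (l\<^sup>2))"
    using half_line_fourier_gaussian_moment(1)[OF assms(1), of z]
    by (subst integrable_cong_AE[OF _ _ AE_half_lineI[OF eq]]) simp_all
  have "(\<integral>x. ?f x \<partial>half_line) = (\<integral>l. 2 * l * ?f (l\<^sup>2) \<partial>half_line)"
    by (rule half_line_substitution_square(2)[OF _ int]) auto
  also have "\<dots> = (\<integral>l. 1 / pi * ?s l \<partial>half_line)"
    by (intro integral_half_line_cong eq) auto
  also have "\<dots> = 1 / pi * (z / \<tau> * (sqrt (pi / (2 * \<tau>)) * exp (- z\<^sup>2 / (2 * \<tau>))))"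
    using half_line_fourier_gaussian_moment[OF assms(1), of z] by simp
  also have "1 / pi * (z / \<tau> * (sqrt (pi / (2 * \<tau>)) * exp (- z\<^sup>2 / (2 * \<tau>))))
      = (sqrt (pi / (2 * \<tau>)) / (pi * \<tau>)) * z * exp (- z\<^sup>2 / (2 * \<tau>))"
    by simp
  also have "sqrt (pi / (2 * \<tau>)) / (pi * \<tau>) = 1 / sqrt (2 * pi * \<tau> ^ 3)"
  proof -
    have "sqrt (pi / (2 * \<tau>)) * sqrt (2 * pi * \<tau> ^ 3) = sqrt ((pi * \<tau>)\<^sup>2)"
      unfolding real_sqrt_mult[symmetric] using assms
      by (intro arg_cong[where f = sqrt]) (simp add: field_simps power2_eq_square power3_eq_cube)
    also have "\<dots> = pi * \<tau>" using assms by simp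
    finally show ?thesis using assms by (simp add: field_simps)
  qed
  finally show ?thesis using assms by (simp add: exc_entrance_def)
qed

text \<open>The kernel is the difference of two Gaussian kernels (reflection at zero), and each of them is a
  cosine integral; their difference is a product of sines. The factor \<open>1 / \<surd>x\<close> comes from
  \<open>dx = 2 l dl\<close>. Without the factor \<open>sin(\<surd>x w)\<close> the integrand is the function whose
  sine transform is the kernel.\<close>

lemma killed_heat_kernel_spectral:
  assumes "0 < \<tau>" "0 < z" "0 < w"
  defines "f \<equiv> \<lambda>x. sin (sqrt x * w) * (sin (sqrt x * z) * (exp (- \<tau> * x / 2) / (pi * sqrt x)))"
  shows "integrable half_line (\<lambda>x. sin (sqrt x * z) * (exp (- \<tau> * x / 2) / (pi * sqrt x)))"
    and "(\<integral>x. f x \<partial>half_line) = killed_heat_kernel \<tau> w z"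
proof -
  let ?c = "\<lambda>a l. exp (- \<tau> * l\<^sup>2 / 2) * cos (a * l)"
  let ?h = "\<lambda>x. sin (sqrt x * z) * (exp (- \<tau> * x / 2) / (pi * sqrt x))"
  have "integrable half_line (\<lambda>l. 2 * l * ?h (l\<^sup>2))"
  proof (rule Bochner_Integration.integrable_bound)
    show "integrable half_line (\<lambda>l. 2 / pi * ?c 0 l)"
      using half_line_fourier_gaussian(1)[OF assms(1), of 0] by simp
    show "AE l in half_line. norm (2 * l * ?h (l\<^sup>2)) \<le> norm (2 / pi * ?c 0 l)"
    proof (rule AE_half_lineI)
      fix l :: real assume "0 < l"
      then have "norm (2 * l * ?h (l\<^sup>2)) = 2 / pi * exp (- \<tau> * l\<^sup>2 / 2) * \<bar>sin (l * z)\<bar>"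
        by (simp add: abs_mult)
      also have "\<dots> \<le> 2 / pi * exp (- \<tau> * l\<^sup>2 / 2)"
        by (intro mult_left_le) auto
      finally show "norm (2 * l * ?h (l\<^sup>2)) \<le> norm (2 / pi * ?c 0 l)" by simp
    qed
  qed measurable
  then show "integrable half_line ?h"
    by (rule half_line_substitution_square(1)[rotated]) measurable
  have eq: "2 * l * f (l\<^sup>2) = 1 / pi * (?c (w - z) l - ?c (w + z) l)" if "0 < l" for l
  proof -
    have "2 * l * f (l\<^sup>2) = 2 / pi * exp (- \<tau> * l\<^sup>2 / 2) * (sin (l * w) * sin (l * z))"
      using that by (simp add: f_def)
    also have "sin (l * w) * sin (l * z) = (cos ((w - z) * l) - cos ((w + z) * l)) / 2"
      unfolding sin_times_sin by (simp add: algebra_simps)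
    finally show ?thesis by (simp add: right_diff_distrib diff_divide_distrib)
  qed
  have int: "integrable half_line (\<lambda>l. 2 * l * f (l\<^sup>2))"
    using half_line_fourier_gaussian(1)[OF assms(1)] unfolding f_def
    by (subst integrable_cong_AE[OF _ _ AE_half_lineI[OF eq[unfolded f_def]]]) simp_all
  have "(\<integral>x. f x \<partial>half_line) = (\<integral>l. 2 * l * f (l\<^sup>2) \<partial>half_line)"
    by (rule half_line_substitution_square(2)[OF _ int]) (auto simp: f_def)
  also have "\<dots> = (\<integral>l. 1 / pi * (?c (w - z) l - ?c (w + z) l) \<partial>half_line)"
    by (intro integral_half_line_cong eq) (auto simp: f_def)
  also have "\<dots> = sqrt (pi / (2 * \<tau>)) / pi * (exp (- (w - z)\<^sup>2 / (2 * \<tau>)) - exp (- (w + z)\<^sup>2 / (2 * \<tau>)))"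
    by (subst integral_mult_right_zero, subst Bochner_Integration.integral_diff)
       (simp_all only: half_line_fourier_gaussian[OF assms(1)],
        simp add: right_diff_distrib diff_divide_distrib)
  also have "sqrt (pi / (2 * \<tau>)) / pi = 1 / sqrt (2 * pi * \<tau>)"
  proof -
    have "sqrt (pi / (2 * \<tau>)) * sqrt (2 * pi * \<tau>) = sqrt (pi\<^sup>2)"
      unfolding real_sqrt_mult[symmetric] using assms
      by (intro arg_cong[where f = sqrt]) (simp add: field_simps power2_eq_square)
    then show ?thesis using assms by (simp add: field_simps)
  qed
  finally show "(\<integral>x. f x \<partial>half_line) = killed_heat_kernel \<tau> w z"
    using assms by (simp add: killed_heat_kernel_def)
qed

section \<open>The transition density and the sine transform\<close>

lemma measurable_trans_density [measurable]:
  "(\<lambda>(x, y). trans_density c x y) \<in> borel_measurable (borel \<Otimes>\<^sub>M borel)"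
  unfolding trans_density_def by measurable

lemma trans_density_nonneg: "0 < c \<Longrightarrow> 0 \<le> x \<Longrightarrow> 0 \<le> y \<Longrightarrow> 0 \<le> trans_density c x y"
  unfolding trans_density_def by (intro divide_nonneg_nonneg mult_nonneg_nonneg add_nonneg_nonneg) auto

text \<open>By \<open>(\<surd>y c - c\<^sup>2)\<^sup>2 \<ge> 0\<close> the denominator is at least \<open>2 \<pi> c\<^sup>3 \<surd>y\<close>. The bound is uniform in
  both arguments, so that a transition of \<open>X\<close> maps integrable functions to bounded ones.\<close>

lemma trans_density_le:
  assumes "0 < c" "0 \<le> x" "0 \<le> y"
  shows "trans_density c x y \<le> 1 / (pi * c\<^sup>2)"
proof -
  let ?D = "(y - x)\<^sup>2 + 2 * (x + y) * c\<^sup>2 + c ^ 4"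
  have "2 * c ^ 3 * sqrt y \<le> y * c\<^sup>2 + c ^ 4"
  proof -
    have "0 \<le> (sqrt y * c - c\<^sup>2)\<^sup>2" by simp
    also have "\<dots> = (sqrt y)\<^sup>2 * c\<^sup>2 + c ^ 4 - 2 * c ^ 3 * sqrt y"
      by (simp add: power2_eq_square eval_nat_numeral algebra_simps)
    finally show ?thesis using assms by simp
  qed
  moreover have "0 \<le> (y - x)\<^sup>2 + 2 * x * c\<^sup>2 + y * c\<^sup>2"
    using assms by simp
  ultimately have D: "2 * c ^ 3 * sqrt y \<le> ?D"
    by (simp add: algebra_simps)
  have "0 < ?D"
    using assms by (intro add_nonneg_pos) auto
  then have "trans_density c x y * (pi * c\<^sup>2) = 2 * c ^ 3 * sqrt y / ?D"
    by (simp add: trans_density_def power2_eq_square power3_eq_cube)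
  also have "\<dots> \<le> 1"
    using D \<open>0 < ?D\<close> by simp
  finally show ?thesis
    using assms by (simp add: field_simps)
qed

lemma integrable_trans_density_mult:
  assumes "0 < c" "0 \<le> x" "integrable half_line G"
  shows "integrable half_line (\<lambda>y. trans_density c x y * G y)"
    and "\<bar>\<integral>y. trans_density c x y * G y \<partial>half_line\<bar> \<le> 1 / (pi * c\<^sup>2) * (\<integral>y. \<bar>G y\<bar> \<partial>half_line)"
proof -
  have [measurable]: "G \<in> borel_measurable borel"
    using borel_measurable_integrable[OF assms(3)] by simp
  have le: "\<bar>trans_density c x y * G y\<bar> \<le> 1 / (pi * c\<^sup>2) * \<bar>G y\<bar>" if "0 < y" for y
    using that assms trans_density_nonneg[of c x y]
      mult_right_mono[OF trans_density_le[of c x y], of "\<bar>G y\<bar>"]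
    by (simp add: abs_mult)
  have bnd: "integrable half_line (\<lambda>y. 1 / (pi * c\<^sup>2) * \<bar>G y\<bar>)"
    using assms by simp
  show int: "integrable half_line (\<lambda>y. trans_density c x y * G y)"
    by (rule Bochner_Integration.integrable_bound[OF bnd])
       (auto intro!: AE_half_lineI order_trans[OF le])
  have "\<bar>\<integral>y. trans_density c x y * G y \<partial>half_line\<bar> \<le> (\<integral>y. \<bar>trans_density c x y * G y\<bar> \<partial>half_line)"
    by (rule integral_abs_bound)
  also have "\<dots> \<le> (\<integral>y. 1 / (pi * c\<^sup>2) * \<bar>G y\<bar> \<partial>half_line)"
    using int bnd by (intro integral_mono_AE AE_half_lineI le) auto
  finally show "\<bar>\<integral>y. trans_density c x y * G y \<partial>half_line\<bar> \<le> 1 / (pi * c\<^sup>2) * (\<integral>y. \<bar>G y\<bar> \<partial>half_line)"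
    by simp
qed

text \<open>For \<open>x = l\<^sup>2\<close> this is the classical sine transform of \<open>l \<mapsto> 2 l G(l\<^sup>2)\<close>; the square root
  makes the argument of \<open>G\<close> the state variable of \<open>X\<close>.\<close>

definition sine_transform :: "(real \<Rightarrow> real) \<Rightarrow> real \<Rightarrow> real" where
  "sine_transform G w = (\<integral>x. sin (sqrt x * w) * G x \<partial>half_line)"

lemma measurable_sine_transform [measurable]:
  assumes [measurable]: "G \<in> borel_measurable borel"
  shows "sine_transform G \<in> borel_measurable borel"
  unfolding sine_transform_def by measurable

lemma abs_sine_transform_le:
  assumes "integrable half_line G"
  shows "\<bar>sine_transform G w\<bar> \<le> (\<integral>x. \<bar>G x\<bar> \<partial>half_line)"
proof -
  have [measurable]: "G \<in> borel_measurable borel"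
    using borel_measurable_integrable[OF assms] by simp
  have int: "integrable half_line (\<lambda>x. sin (sqrt x * w) * G x)"
    by (rule Bochner_Integration.integrable_bound[OF assms])
       (auto simp: abs_mult intro!: mult_right_le_one_le mult_left_le_one_le)
  have "\<bar>sine_transform G w\<bar> \<le> (\<integral>x. \<bar>sin (sqrt x * w) * G x\<bar> \<partial>half_line)"
    unfolding sine_transform_def by (rule integral_abs_bound)
  also have "\<dots> \<le> (\<integral>x. \<bar>G x\<bar> \<partial>half_line)"
  proof (rule integral_mono)
    show "\<bar>sin (sqrt x * w) * G x\<bar> \<le> \<bar>G x\<bar>" for x
      by (simp add: abs_mult mult_left_le_one_le)
  qed (use int assms in \<open>auto intro!: integrable_abs simp del: abs_mult\<close>)
  finally show ?thesis .
qed

text \<open>Fubini, with \<open>\<bar>f w\<bar> \<bar>k y\<bar>\<close> as dominating function.\<close>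

lemma sine_transform_swap:
  assumes "integrable half_line f" "integrable half_line k"
  shows "(\<integral>w. f w * sine_transform k w \<partial>half_line)
    = (\<integral>y. k y * (\<integral>w. f w * sin (sqrt y * w) \<partial>half_line) \<partial>half_line)"
proof -
  have [measurable]: "f \<in> borel_measurable borel" "k \<in> borel_measurable borel"
    using borel_measurable_integrable[OF assms(1)] borel_measurable_integrable[OF assms(2)] by auto
  have int1: "integrable half_line (\<lambda>y. f w * (sin (sqrt y * w) * k y))" for w
    by (intro integrable_mult_right Bochner_Integration.integrable_bound[OF assms(2)])
       (auto simp: abs_mult intro!: mult_left_le_one_le)
  have "integrable (half_line \<Otimes>\<^sub>M half_line) (\<lambda>(w, y). f w * (sin (sqrt y * w) * k y))"
  proof (rule half_line_pair.Fubini_integrable)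
    show "integrable half_line (\<lambda>w. \<integral>y. norm (case (w, y) of (w, y) \<Rightarrow> f w * (sin (sqrt y * w) * k y)) \<partial>half_line)"
    proof (rule Bochner_Integration.integrable_bound)
      show "integrable half_line (\<lambda>w. \<bar>f w\<bar> * (\<integral>y. \<bar>k y\<bar> \<partial>half_line))"
        using assms by auto
      show "AE w in half_line. norm (\<integral>y. norm (case (w, y) of (w, y) \<Rightarrow> f w * (sin (sqrt y * w) * k y)) \<partial>half_line)
          \<le> norm (\<bar>f w\<bar> * (\<integral>y. \<bar>k y\<bar> \<partial>half_line))"
      proof (rule AE_I2)
        fix w
        have "(\<integral>y. \<bar>f w * (sin (sqrt y * w) * k y)\<bar> \<partial>half_line) \<le> (\<integral>y. \<bar>f w\<bar> * \<bar>k y\<bar> \<partial>half_line)"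
        proof (rule integral_mono)
          show "\<bar>f w * (sin (sqrt y * w) * k y)\<bar> \<le> \<bar>f w\<bar> * \<bar>k y\<bar>" for y
            by (auto simp: abs_mult intro!: mult_left_mono mult_left_le_one_le)
          show "integrable half_line (\<lambda>y. \<bar>f w * (sin (sqrt y * w) * k y)\<bar>)"
            using int1 by (rule integrable_abs)
        qed (use assms in auto)
        then show "norm (\<integral>y. norm (case (w, y) of (w, y) \<Rightarrow> f w * (sin (sqrt y * w) * k y)) \<partial>half_line)
          \<le> norm (\<bar>f w\<bar> * (\<integral>y. \<bar>k y\<bar> \<partial>half_line))"
          by simp
      qed
    qed measurable
  qed (use int1 in auto)
  then have "(\<integral>w. (\<integral>y. f w * (sin (sqrt y * w) * k y) \<partial>half_line) \<partial>half_line)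
      = (\<integral>y. (\<integral>w. f w * (sin (sqrt y * w) * k y) \<partial>half_line) \<partial>half_line)"
    by (rule half_line_pair.Fubini_integral[symmetric])
  also have "\<dots> = (\<integral>y. (\<integral>w. k y * (f w * sin (sqrt y * w)) \<partial>half_line) \<partial>half_line)"
    by (simp add: ac_simps)
  finally show ?thesis
    by (simp add: sine_transform_def)
qed

text \<open>Pairing two sine transforms with weight \<open>exp(-c w)\<close> is pairing the original functions through
  the transition density of \<open>X\<close> at time \<open>c\<close>: both transforms are opened, and the integral over
  \<open>w\<close> that remains inside is \<open>half_line_laplace_sin_sin\<close>. This is the only step in which the
  variables of the excursion are exchanged for those of \<open>X\<close>.\<close>

lemma sine_transform_parseval:
  assumes "0 < c" and k: "integrable half_line k" and G: "integrable half_line G"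
  shows "integrable half_line (\<lambda>w. sine_transform k w * (exp (- c * w) * sine_transform G w))"
    and "(\<integral>w. sine_transform k w * (exp (- c * w) * sine_transform G w) \<partial>half_line)
    = (\<integral>y. k y * (pi * sqrt y * (\<integral>x. trans_density c y x * G x \<partial>half_line)) \<partial>half_line)"
proof -
  have [measurable]: "k \<in> borel_measurable borel" "G \<in> borel_measurable borel"
    using borel_measurable_integrable[OF k] borel_measurable_integrable[OF G] by auto
  define C where "C = (\<integral>x. \<bar>G x\<bar> \<partial>half_line)"
  note exp_int = half_line_integral_exp(1)[OF \<open>0 < c\<close>]
  have int: "integrable half_line (\<lambda>w. exp (- c * w) * sine_transform G w)"
  proof (rule Bochner_Integration.integrable_bound)
    show "integrable half_line (\<lambda>w. exp (- c * w) * C)" using exp_int by simp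
    show "AE w in half_line. norm (exp (- c * w) * sine_transform G w) \<le> norm (exp (- c * w) * C)"
      using abs_sine_transform_le[OF G] unfolding C_def
      by (auto simp: abs_mult intro!: mult_left_mono order_trans[OF _ abs_ge_self])
  qed measurable
  show "integrable half_line (\<lambda>w. sine_transform k w * (exp (- c * w) * sine_transform G w))"
  proof (rule Bochner_Integration.integrable_bound)
    show "integrable half_line (\<lambda>w. (\<integral>x. \<bar>k x\<bar> \<partial>half_line) * (exp (- c * w) * sine_transform G w))"
      using int by simp
    show "AE w in half_line. norm (sine_transform k w * (exp (- c * w) * sine_transform G w))
      \<le> norm ((\<integral>x. \<bar>k x\<bar> \<partial>half_line) * (exp (- c * w) * sine_transform G w))"
      using abs_sine_transform_le[OF k]
      by (intro AE_I2) (auto simp: abs_mult intro!: mult_right_mono)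
  qed measurable
  have inner: "(\<integral>w. exp (- c * w) * sine_transform G w * sin (sqrt y * w) \<partial>half_line)
      = pi * sqrt y * (\<integral>x. trans_density c y x * G x \<partial>half_line)" if "0 < y" for y
  proof -
    have "integrable half_line (\<lambda>w. exp (- c * w) * sin (sqrt y * w))"
      by (rule Bochner_Integration.integrable_bound[OF exp_int])
         (auto simp: abs_mult intro!: mult_left_le)
    then have "(\<integral>w. exp (- c * w) * sin (sqrt y * w) * sine_transform G w \<partial>half_line)
        = (\<integral>x. G x * (\<integral>w. exp (- c * w) * sin (sqrt y * w) * sin (sqrt x * w) \<partial>half_line) \<partial>half_line)"
      by (rule sine_transform_swap[OF _ G])
    also have "\<dots> = (\<integral>x. pi * sqrt y * (trans_density c y x * G x) \<partial>half_line)"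
    proof (rule integral_half_line_cong)
      show "G x * (\<integral>w. exp (- c * w) * sin (sqrt y * w) * sin (sqrt x * w) \<partial>half_line)
          = pi * sqrt y * (trans_density c y x * G x)" if "0 < x" for x
        using half_line_laplace_sin_sin[OF \<open>0 < c\<close> \<open>0 < y\<close> \<open>0 < x\<close>] by (simp add: mult.assoc)
    qed measurable
    also have "\<dots> = pi * sqrt y * (\<integral>x. trans_density c y x * G x \<partial>half_line)"
      by (rule integral_mult_right_zero)
    finally show ?thesis by (simp only: ac_simps)
  qed
  have "(\<integral>w. exp (- c * w) * sine_transform G w * sine_transform k w \<partial>half_line)
      = (\<integral>y. k y * (\<integral>w. exp (- c * w) * sine_transform G w * sin (sqrt y * w) \<partial>half_line) \<partial>half_line)"
    by (rule sine_transform_swap[OF int k])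
  also have "\<dots> = (\<integral>y. k y * (pi * sqrt y * (\<integral>x. trans_density c y x * G x \<partial>half_line)) \<partial>half_line)"
    by (rule integral_half_line_cong) (simp_all only: inner, measurable)
  finally show "(\<integral>w. sine_transform k w * (exp (- c * w) * sine_transform G w) \<partial>half_line)
    = (\<integral>y. k y * (pi * sqrt y * (\<integral>x. trans_density c y x * G x \<partial>half_line)) \<partial>half_line)"
    by (simp only: ac_simps)
qed

section \<open>The backward recursion\<close>

text \<open>The backward recursion for exponential functionals of \<open>X\<close>. The value \<open>feynman_kac \<tau> c n x\<close>
  is the expectation, for \<open>X\<close> started at \<open>x\<close>, of the exponential of minus one half of the
  sum of \<open>n + 1\<close> values of \<open>X\<close> with weights
  \<open>\<tau> n, \<dots>, \<tau> 0\<close>, separated by \<open>n\<close> time steps \<open>c n, \<dots>, c 1\<close>. The indices count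
  backwards in the time of \<open>X\<close>, since the recursion starts at the last time.\<close>

primrec feynman_kac :: "(nat \<Rightarrow> real) \<Rightarrow> (nat \<Rightarrow> real) \<Rightarrow> nat \<Rightarrow> real \<Rightarrow> real" where
  "feynman_kac \<tau> c 0 = (\<lambda>x. exp (- \<tau> 0 * x / 2))"
| "feynman_kac \<tau> c (Suc n) = (\<lambda>x. exp (- \<tau> (Suc n) * x / 2) *
     (\<integral>y. trans_density (c (Suc n)) x y * feynman_kac \<tau> c n y \<partial>half_line))"

lemma measurable_feynman_kac [measurable]: "feynman_kac \<tau> c n \<in> borel_measurable borel"
  by (induction n) (simp_all, measurable)

lemma feynman_kac_nonneg:
  assumes "\<And>k. k \<in> {1..n} \<Longrightarrow> 0 < c k" "0 \<le> x"
  shows "0 \<le> feynman_kac \<tau> c n x"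
  using assms
proof (induction n arbitrary: x)
  case (Suc n)
  then show ?case
    by (auto intro!: mult_nonneg_nonneg integral_nonneg_AE AE_half_lineI trans_density_nonneg)
qed simp

lemma integrable_exp_mult_half:
  assumes "0 < a"
  shows "integrable half_line (\<lambda>x. exp (- a * x / 2))"
  using half_line_integral_exp(1)[of "a / 2"] assms by simp

lemma integrable_feynman_kac:
  assumes "\<And>k. k \<le> n \<Longrightarrow> 0 < \<tau> k" "\<And>k. k \<in> {1..n} \<Longrightarrow> 0 < c k"
  shows "integrable half_line (feynman_kac \<tau> c n)"
  using assms
proof (induction n)
  case 0
  then show ?case using integrable_exp_mult_half[of "\<tau> 0"] by simp
next
  case (Suc n)
  have IH: "integrable half_line (feynman_kac \<tau> c n)" by (rule Suc.IH) (use Suc.prems in auto)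
  define C where "C = 1 / (pi * (c (Suc n))\<^sup>2) * (\<integral>y. \<bar>feynman_kac \<tau> c n y\<bar> \<partial>half_line)"
  show ?case
  proof (rule Bochner_Integration.integrable_bound)
    show "integrable half_line (\<lambda>x. exp (- \<tau> (Suc n) * x / 2) * C)"
      using integrable_exp_mult_half[of "\<tau> (Suc n)"] Suc.prems by simp
    show "AE x in half_line. norm (feynman_kac \<tau> c (Suc n) x) \<le> norm (exp (- \<tau> (Suc n) * x / 2) * C)"
    proof (rule AE_half_lineI)
      fix x :: real assume "0 < x"
      then have "\<bar>\<integral>y. trans_density (c (Suc n)) x y * feynman_kac \<tau> c n y \<partial>half_line\<bar> \<le> C"
        unfolding C_def by (intro integrable_trans_density_mult(2) IH) (use Suc.prems in auto)
      then show "norm (feynman_kac \<tau> c (Suc n) x) \<le> norm (exp (- \<tau> (Suc n) * x / 2) * C)"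
        by (auto simp: abs_mult)
    qed
  qed simp
qed

text \<open>The rescaled process \<open>v X\<^bsub>t/\<surd>v\<^esub>\<close> has the law of \<open>X\<close>, because
  \<open>trans_density (c / \<surd>v) x y = v trans_density c (v x) (v y)\<close>.\<close>

lemma feynman_kac_scale:
  assumes "0 < v" "0 \<le> x"
  shows "feynman_kac (\<lambda>k. v * \<tau> k) (\<lambda>k. c k / sqrt v) n x = feynman_kac \<tau> c n (v * x)"
  using assms(2)
proof (induction n arbitrary: x)
  case 0
  then show ?case by simp
next
  case (Suc n)
  let ?F = "feynman_kac \<tau> c n" and ?c = "c (Suc n)"
  have scale: "trans_density (?c / sqrt v) x y = v * trans_density ?c (v * x) (v * y)" for y
  proof -
    (* Writing v = r^2 turns the claim into an identity of rational functions in r. *)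
    obtain r where r: "0 < r" "sqrt v = r" "v = r\<^sup>2"
      using \<open>0 < v\<close> by (metis real_sqrt_gt_zero real_sqrt_pow2 less_imp_le)
    define K where "K = (y - x)\<^sup>2 + 2 * (x + y) * (?c / r)\<^sup>2 + (?c / r) ^ 4"
    have D: "(v * y - v * x)\<^sup>2 + 2 * (v * x + v * y) * ?c\<^sup>2 + ?c ^ 4 = r ^ 4 * K"
      using \<open>0 < r\<close> unfolding r(3) K_def
      by (simp add: field_simps power2_eq_square eval_nat_numeral)
    show ?thesis
      unfolding trans_density_def D r(2) real_sqrt_mult K_def[symmetric]
      using \<open>0 < r\<close> unfolding r(3) by (simp add: field_simps eval_nat_numeral)
  qed
  have "(\<integral>y. trans_density (?c / sqrt v) x y * feynman_kac (\<lambda>k. v * \<tau> k) (\<lambda>k. c k / sqrt v) n y \<partial>half_line)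
      = (\<integral>y. v * (trans_density ?c (v * x) (v * y) * ?F (v * y)) \<partial>half_line)"
    by (rule integral_half_line_cong) (auto simp: Suc.IH scale)
  also have "\<dots> = (\<integral>y. trans_density ?c (v * x) y * ?F y \<partial>half_line)"
    using half_line_integral_scale[of "\<lambda>y. trans_density ?c (v * x) y * ?F y" v] \<open>0 < v\<close> by simp
  finally show ?case by (simp add: ac_simps)
qed

section \<open>The Laplace functional of the excursion\<close>

lemma sine_transform_exp:
  assumes "0 < \<tau>" "0 < z"
  shows "sine_transform (\<lambda>x. exp (- \<tau> * x / 2)) z = 2 * pi * exc_entrance \<tau> z"
  using exc_entrance_spectral[OF assms] by (simp add: sine_transform_def field_simps)

lemma exc_entrance_nonneg: "0 < \<tau> \<Longrightarrow> 0 \<le> exc_entrance \<tau> z"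
  by (auto simp: exc_entrance_def indicator_def)

lemma killed_heat_kernel_nonneg:
  assumes "0 < \<tau>"
  shows "0 \<le> killed_heat_kernel \<tau> w z"
proof -
  have "- (w + z)\<^sup>2 / (2 * \<tau>) \<le> - (w - z)\<^sup>2 / (2 * \<tau>)" if "0 < w" "0 < z"
    using that assms by (intro divide_right_mono) (auto simp: power2_eq_square algebra_simps)
  then show ?thesis
    using assms by (auto simp: killed_heat_kernel_def indicator_def)
qed

lemma measurable_exc_entrance [measurable]: "exc_entrance \<tau> \<in> borel_measurable borel"
  unfolding exc_entrance_def by measurable

lemma measurable_killed_heat_kernel [measurable]:
  "(\<lambda>(x, y). killed_heat_kernel \<tau> x y) \<in> borel_measurable (borel \<Otimes>\<^sub>M borel)"
  unfolding killed_heat_kernel_def by measurable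

text \<open>Running the killed motion for one more time step, on the side of the sine transforms: the kernel
  is itself a sine transform, so the Parseval identity produces the next function of the backward
  recursion. The factor \<open>\<pi> \<surd>x\<close> of the Parseval identity cancels the denominator
  in the spectral representation of the kernel.\<close>

lemma killed_heat_kernel_sine_transform:
  assumes "\<And>k. k \<le> n \<Longrightarrow> 0 < \<tau> k" "\<And>k. k \<in> {1..Suc n} \<Longrightarrow> 0 < c k"
    and "0 < \<tau> (Suc n)" "0 < z"
  defines "g \<equiv> \<lambda>w. killed_heat_kernel (\<tau> (Suc n)) w z *
    (exp (- c (Suc n) * w) * sine_transform (feynman_kac \<tau> c n) w)"
  shows "integrable half_line g"
    and "(\<integral>w. g w \<partial>half_line) = sine_transform (feynman_kac \<tau> c (Suc n)) z"
proof -
  let ?c = "c (Suc n)" and ?\<tau> = "\<tau> (Suc n)" and ?G = "feynman_kac \<tau> c n"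
  let ?k = "\<lambda>x. sin (sqrt x * z) * (exp (- ?\<tau> * x / 2) / (pi * sqrt x))"
  have "0 < ?c" using assms by simp
  have G: "integrable half_line ?G" by (rule integrable_feynman_kac) (use assms in auto)
  have k: "integrable half_line ?k"
    by (rule killed_heat_kernel_spectral(1)) (use assms in auto)
  have kernel: "sine_transform ?k w = killed_heat_kernel ?\<tau> w z" if "0 < w" for w
    unfolding sine_transform_def by (rule killed_heat_kernel_spectral(2)) (use assms that in auto)
  note P = sine_transform_parseval[OF \<open>0 < ?c\<close> k G]
  show "integrable half_line g"
    unfolding g_def
    by (rule iffD1[OF integrable_cong_AE[OF _ _ AE_half_lineI] P(1)]) (simp_all only: kernel, measurable)
  have "(\<integral>w. g w \<partial>half_line)
      = (\<integral>w. sine_transform ?k w * (exp (- ?c * w) * sine_transform ?G w) \<partial>half_line)"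
    unfolding g_def by (rule integral_half_line_cong) (simp_all only: kernel, measurable)
  also have "\<dots> = sine_transform (feynman_kac \<tau> c (Suc n)) z"
    unfolding P(2) unfolding sine_transform_def by (rule integral_half_line_cong) auto
  finally show "(\<integral>w. g w \<partial>half_line) = sine_transform (feynman_kac \<tau> c (Suc n)) z" .
qed

text \<open>A sine transform has no sign in general. This one is nonnegative as it is, up to a constant, the
  density of the entrance law propagated by nonnegative kernels and weights.\<close>

lemma sine_transform_feynman_kac_nonneg:
  assumes "\<And>k. k \<le> n \<Longrightarrow> 0 < \<tau> k" "\<And>k. k \<in> {1..n} \<Longrightarrow> 0 < c k" "0 < z"
  shows "0 \<le> sine_transform (feynman_kac \<tau> c n) z"
  using assms
proof (induction n arbitrary: z)
  case 0
  then show ?case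
    using sine_transform_exp[of "\<tau> 0" z] exc_entrance_nonneg[of "\<tau> 0" z] by simp
next
  case (Suc n)
  have "0 \<le> (\<integral>w. killed_heat_kernel (\<tau> (Suc n)) w z *
      (exp (- c (Suc n) * w) * sine_transform (feynman_kac \<tau> c n) w) \<partial>half_line)"
    using Suc by (intro integral_nonneg_AE AE_half_lineI mult_nonneg_nonneg
        killed_heat_kernel_nonneg Suc.IH) auto
  also have "\<dots> = sine_transform (feynman_kac \<tau> c (Suc n)) z"
    using Suc.prems by (intro killed_heat_kernel_sine_transform(2)) auto
  finally show ?case .
qed

lemma nn_integral_killed_heat_kernel:
  assumes "\<And>k. k \<le> Suc n \<Longrightarrow> 0 < \<tau> k" "\<And>k. k \<in> {1..Suc n} \<Longrightarrow> 0 < c k"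
  shows "(\<integral>\<^sup>+w. ennreal (sine_transform (feynman_kac \<tau> c n) w / (2 * pi)) * ennreal (exp (- c (Suc n) * w)) *
      ennreal (killed_heat_kernel (\<tau> (Suc n)) w z) \<partial>half_line)
    = indicator {0<..} z * ennreal (sine_transform (feynman_kac \<tau> c (Suc n)) z / (2 * pi))"
proof (cases "0 < z")
  case True
  let ?S = "sine_transform (feynman_kac \<tau> c n)"
  let ?g = "\<lambda>w. killed_heat_kernel (\<tau> (Suc n)) w z * (exp (- c (Suc n) * w) * ?S w)"
  have S: "0 \<le> ?S w" if "0 < w" for w
    by (rule sine_transform_feynman_kac_nonneg) (use assms that in auto)
  have g: "0 \<le> ?g w" if "0 < w" for w
    using assms S[OF that] by (intro mult_nonneg_nonneg killed_heat_kernel_nonneg) auto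
  have int: "integrable half_line ?g" "(\<integral>w. ?g w \<partial>half_line) = sine_transform (feynman_kac \<tau> c (Suc n)) z"
    by (rule killed_heat_kernel_sine_transform; use assms True in auto)+
  have "(\<integral>\<^sup>+w. ennreal (?S w / (2 * pi)) * ennreal (exp (- c (Suc n) * w)) *
      ennreal (killed_heat_kernel (\<tau> (Suc n)) w z) \<partial>half_line)
    = (\<integral>\<^sup>+w. ennreal (?g w / (2 * pi)) \<partial>half_line)"
    using S assms
    by (intro nn_integral_half_line_cong)
       (simp add: killed_heat_kernel_nonneg ac_simps flip: ennreal_mult')
  also have "\<dots> = ennreal (\<integral>w. ?g w / (2 * pi) \<partial>half_line)"
    using int g by (intro nn_integral_eq_integral AE_half_lineI) auto
  finally show ?thesis using True int by simp
next
  case False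
  then show ?thesis by (simp add: killed_heat_kernel_def)
qed

text \<open>The arbitrary test function \<open>h\<close> of the last coordinate makes the induction possible: a further
  time point is integrated outermost, and the kernel leading to it is used as test function for
  the paths with one time point fewer.\<close>

lemma nn_integral_killed_paths:
  assumes "\<And>k. k \<le> n \<Longrightarrow> 0 < \<tau> k" "\<And>k. k \<in> {1..Suc n} \<Longrightarrow> 0 < c k"
    and "h \<in> borel_measurable borel"
  shows "(\<integral>\<^sup>+y. ennreal (exc_entrance (\<tau> 0) (y 1))
      * (\<Prod>k\<in>{1..n}. ennreal (killed_heat_kernel (\<tau> k) (y k) (y (Suc k))))
      * (\<Prod>k\<in>{1..Suc n}. ennreal (exp (- c k * y k))) * h (y (Suc n)) \<partial>(\<Pi>\<^sub>M k\<in>{1..Suc n}. lborel))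
    = (\<integral>\<^sup>+w. ennreal (sine_transform (feynman_kac \<tau> c n) w / (2 * pi)) * ennreal (exp (- c (Suc n) * w)) * h w \<partial>half_line)"
  using assms
proof (induction n arbitrary: h)
  case 0
  have [measurable]: "h \<in> borel_measurable borel" by fact
  interpret product_sigma_finite "\<lambda>_::nat. lborel :: real measure" ..
  have "(\<integral>\<^sup>+y. ennreal (exc_entrance (\<tau> 0) (y 1)) * ennreal (exp (- c 1 * y 1)) * h (y 1) \<partial>(\<Pi>\<^sub>M k\<in>{1::nat}. lborel))
      = (\<integral>\<^sup>+w. ennreal (exc_entrance (\<tau> 0) w) * ennreal (exp (- c 1 * w)) * h w \<partial>lborel)"
    by (rule product_nn_integral_singleton[where i = 1 and f = "\<lambda>w. ennreal (exc_entrance (\<tau> 0) w) * ennreal (exp (- c 1 * w)) * h w"]) simp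
  also have "\<dots> = (\<integral>\<^sup>+w. ennreal (exc_entrance (\<tau> 0) w) * ennreal (exp (- c 1 * w)) * h w \<partial>half_line)"
    by (subst nn_integral_half_line) (auto intro!: nn_integral_cong simp: exc_entrance_def indicator_def)
  also have "\<dots> = (\<integral>\<^sup>+w. ennreal (sine_transform (feynman_kac \<tau> c 0) w / (2 * pi)) * ennreal (exp (- c 1 * w)) * h w \<partial>half_line)"
  proof (rule nn_integral_half_line_cong)
    fix w :: real assume "0 < w"
    then show "ennreal (exc_entrance (\<tau> 0) w) * ennreal (exp (- c 1 * w)) * h w
        = ennreal (sine_transform (feynman_kac \<tau> c 0) w / (2 * pi)) * ennreal (exp (- c 1 * w)) * h w"
      using 0 sine_transform_exp[of "\<tau> 0" w] by simp
  qed
  finally show ?case by simp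
next
  case (Suc n)
  have [measurable]: "h \<in> borel_measurable borel" by fact
  interpret product_sigma_finite "\<lambda>_::nat. lborel :: real measure" ..
  let ?N = "Suc n" and ?M = "Suc (Suc n)"
  let ?A = "\<lambda>y. ennreal (exc_entrance (\<tau> 0) (y 1))
      * (\<Prod>k\<in>{1..n}. ennreal (killed_heat_kernel (\<tau> k) (y k) (y (Suc k))))
      * (\<Prod>k\<in>{1..Suc n}. ennreal (exp (- c k * y k)))"
  let ?B = "\<lambda>y. ennreal (exc_entrance (\<tau> 0) (y 1))
      * (\<Prod>k\<in>{1..Suc n}. ennreal (killed_heat_kernel (\<tau> k) (y k) (y (Suc k))))
      * (\<Prod>k\<in>{1..?M}. ennreal (exp (- c k * y k))) * h (y ?M)"
  have ins: "{1..?M} = insert ?M {1..?N}" by auto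
  have upd: "?B (x(?M := z)) = (?A x * ennreal (killed_heat_kernel (\<tau> ?N) (x ?N) z)) *
      (ennreal (exp (- c ?M * z)) * h z)" for x z
  proof -
    have "(\<Prod>k\<in>{1..n}. ennreal (killed_heat_kernel (\<tau> k) ((x(?M := z)) k) ((x(?M := z)) (Suc k))))
        = (\<Prod>k\<in>{1..n}. ennreal (killed_heat_kernel (\<tau> k) (x k) (x (Suc k))))"
      by (rule prod.cong) auto
    moreover have "(\<Prod>k\<in>{1..?N}. ennreal (exp (- c k * (x(?M := z)) k))) = (\<Prod>k\<in>{1..?N}. ennreal (exp (- c k * x k)))"
      by (rule prod.cong) auto
    ultimately show ?thesis by (simp add: ac_simps)
  qed
  have "(\<integral>\<^sup>+y. ?B y \<partial>(\<Pi>\<^sub>M k\<in>{1..?M}. lborel))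
      = (\<integral>\<^sup>+z. (\<integral>\<^sup>+x. ?B (x(?M := z)) \<partial>(\<Pi>\<^sub>M k\<in>{1..?N}. lborel)) \<partial>lborel)"
    unfolding ins by (rule product_nn_integral_insert_rev) (auto intro!: borel_measurable_times_ennreal)
  also have "\<dots> = (\<integral>\<^sup>+z. (\<integral>\<^sup>+w. ennreal (sine_transform (feynman_kac \<tau> c n) w / (2 * pi)) * ennreal (exp (- c ?N * w)) *
      ennreal (killed_heat_kernel (\<tau> ?N) w z) \<partial>half_line) * (ennreal (exp (- c ?M * z)) * h z) \<partial>lborel)"
  proof (rule nn_integral_cong)
    fix z
    have "(\<integral>\<^sup>+x. ?B (x(?M := z)) \<partial>(\<Pi>\<^sub>M k\<in>{1..?N}. lborel))
        = (\<integral>\<^sup>+x. ?A x * ennreal (killed_heat_kernel (\<tau> ?N) (x ?N) z) \<partial>(\<Pi>\<^sub>M k\<in>{1..?N}. lborel)) *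
          (ennreal (exp (- c ?M * z)) * h z)"
      unfolding upd by (rule nn_integral_multc) simp
    also have "(\<integral>\<^sup>+x. ?A x * ennreal (killed_heat_kernel (\<tau> ?N) (x ?N) z) \<partial>(\<Pi>\<^sub>M k\<in>{1..?N}. lborel))
        = (\<integral>\<^sup>+w. ennreal (sine_transform (feynman_kac \<tau> c n) w / (2 * pi)) * ennreal (exp (- c ?N * w)) *
          ennreal (killed_heat_kernel (\<tau> ?N) w z) \<partial>half_line)"
      by (rule Suc.IH) (use Suc.prems in auto)
    finally show "(\<integral>\<^sup>+x. ?B (x(?M := z)) \<partial>(\<Pi>\<^sub>M k\<in>{1..?N}. lborel))
        = (\<integral>\<^sup>+w. ennreal (sine_transform (feynman_kac \<tau> c n) w / (2 * pi)) * ennreal (exp (- c ?N * w)) *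
          ennreal (killed_heat_kernel (\<tau> ?N) w z) \<partial>half_line) * (ennreal (exp (- c ?M * z)) * h z)" .
  qed
  also have "\<dots> = (\<integral>\<^sup>+z. indicator {0<..} z * (ennreal (sine_transform (feynman_kac \<tau> c ?N) z / (2 * pi)) * 
      ennreal (exp (- c ?M * z)) * h z) \<partial>lborel)"
    by (subst nn_integral_killed_heat_kernel) (use Suc.prems in \<open>auto simp: mult.assoc\<close>)
  also have "\<dots> = (\<integral>\<^sup>+z. ennreal (sine_transform (feynman_kac \<tau> c ?N) z / (2 * pi)) * 
      ennreal (exp (- c ?M * z)) * h z \<partial>half_line)"
    by (rule nn_integral_half_line[symmetric]) simp
  finally show ?case .
qed

text \<open>The transition of an integrable function is bounded, so \<open>half_line_gamma_three_halves\<close> dominates.\<close>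

lemma integrable_sqrt_exp_transition:
  assumes "0 < a" "integrable half_line G" "0 < b"
  shows "integrable half_line (\<lambda>x. sqrt x * exp (- a * x / 2) * (\<integral>y. trans_density b x y * G y \<partial>half_line))"
proof -
  have [measurable]: "G \<in> borel_measurable borel"
    using borel_measurable_integrable[OF assms(2)] by simp
  define C where "C = 1 / (pi * b\<^sup>2) * (\<integral>y. \<bar>G y\<bar> \<partial>half_line)"
  have base: "integrable half_line (\<lambda>x. sqrt x * exp (- (a / 2) * x))"
    by (rule integrableI_nonneg)
       (use half_line_gamma_three_halves[of "a / 2"] assms in \<open>auto intro!: AE_half_lineI\<close>)
  show ?thesis
  proof (rule Bochner_Integration.integrable_bound)
    show "integrable half_line (\<lambda>x. C * (sqrt x * exp (- (a / 2) * x)))"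
      using base by simp
    show "AE x in half_line. norm (sqrt x * exp (- a * x / 2) * (\<integral>y. trans_density b x y * G y \<partial>half_line))
        \<le> norm (C * (sqrt x * exp (- (a / 2) * x)))"
    proof (rule AE_half_lineI)
      fix x :: real assume "0 < x"
      then have "\<bar>\<integral>y. trans_density b x y * G y \<partial>half_line\<bar> \<le> C"
        unfolding C_def by (intro integrable_trans_density_mult(2) assms) auto
      then have "sqrt x * exp (- a * x / 2) * \<bar>\<integral>y. trans_density b x y * G y \<partial>half_line\<bar>
          \<le> sqrt x * exp (- a * x / 2) * \<bar>C\<bar>"
        using \<open>0 < x\<close> by (intro mult_left_mono) auto
      then show "norm (sqrt x * exp (- a * x / 2) * (\<integral>y. trans_density b x y * G y \<partial>half_line))
        \<le> norm (C * (sqrt x * exp (- (a / 2) * x)))"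
        using \<open>0 < x\<close> by (simp add: abs_mult ac_simps)
    qed
  qed measurable
qed

text \<open>The joint density consists of the killed paths started from the entrance law, closed by a second
  entrance density for the time that remains until the excursion ends. The latter is, up to the
  factor \<open>2 \<pi>\<close>, the sine transform of an exponential function, so one more application of the Parseval identity removes the last
  path variable. The normalising constants combine by \<open>\<surd>(8 \<pi>) / (4 \<pi>) = 1 / \<surd>(2 \<pi>)\<close>.\<close>

lemma (in brownian_excursion) excursion_laplace_transform:
  fixes u c :: "nat \<Rightarrow> real" and n :: nat
  assumes "0 < u 1" "u (Suc n) < 1" "\<And>k. k \<in> {1..n} \<Longrightarrow> u k < u (Suc k)"
    and c: "\<And>k. k \<in> {1..Suc n} \<Longrightarrow> 0 < c k"
    and \<tau>: "\<tau> 0 = u 1" "\<And>k. k \<in> {1..n} \<Longrightarrow> \<tau> k = u (Suc k) - u k"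
  shows "(\<integral>\<^sup>+\<omega>. ennreal (exp (- (\<Sum>k=1..Suc n. c k * B (u k) \<omega>))) \<partial>M)
    = (\<integral>\<^sup>+x. ennreal (1 / sqrt (2 * pi) * (sqrt x * exp (- (1 - u (Suc n)) * x / 2) *
        (\<integral>y. trans_density (c (Suc n)) x y * feynman_kac \<tau> c n y \<partial>half_line))) \<partial>half_line)"
proof -
  let ?N = "Suc n" and ?G = "feynman_kac \<tau> c n" and ?a = "1 - u (Suc n)"
  let ?P = "\<Pi>\<^sub>M k\<in>{1..Suc n}. lborel :: real measure"
  have \<tau>_pos: "0 < \<tau> k" if "k \<le> n" for k
    using that assms(1,3) \<tau> by (cases k) auto
  have "0 < ?a" "0 < c ?N" using assms by auto
  have dist: "distributed M ?P (\<lambda>\<omega>. \<lambda>k\<in>{1..?N}. B (u k) \<omega>) (\<lambda>y. ennreal (excursion_density ?N u y))"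
    using assms by (intro joint_density) auto
  have "(\<integral>\<^sup>+\<omega>. ennreal (exp (- (\<Sum>k=1..?N. c k * B (u k) \<omega>))) \<partial>M)
      = (\<integral>\<^sup>+y. ennreal (excursion_density ?N u y) * (\<Prod>k\<in>{1..?N}. ennreal (exp (- c k * y k))) \<partial>?P)"
  proof -
    have "(\<integral>\<^sup>+\<omega>. ennreal (exp (- (\<Sum>k=1..?N. c k * B (u k) \<omega>))) \<partial>M)
        = (\<integral>\<^sup>+\<omega>. (\<Prod>k\<in>{1..?N}. ennreal (exp (- c k * (\<lambda>k\<in>{1..?N}. B (u k) \<omega>) k))) \<partial>M)"
    proof (rule nn_integral_cong)
      fix \<omega>
      have "(\<Prod>k\<in>{1..?N}. ennreal (exp (- c k * (\<lambda>k\<in>{1..?N}. B (u k) \<omega>) k)))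
          = (\<Prod>k\<in>{1..?N}. ennreal (exp (- c k * B (u k) \<omega>)))"
        by (rule prod.cong) auto
      also have "\<dots> = ennreal (exp (\<Sum>k=1..?N. - c k * B (u k) \<omega>))"
        by (simp only: exp_sum finite_atLeastAtMost) (rule prod_ennreal, simp)
      finally show "ennreal (exp (- (\<Sum>k=1..?N. c k * B (u k) \<omega>)))
          = (\<Prod>k\<in>{1..?N}. ennreal (exp (- c k * (\<lambda>k\<in>{1..?N}. B (u k) \<omega>) k)))"
        by (simp only: mult_minus_left sum_negf)
    qed
    also have "\<dots> = (\<integral>\<^sup>+y. ennreal (excursion_density ?N u y) * (\<Prod>k\<in>{1..?N}. ennreal (exp (- c k * y k))) \<partial>?P)"
      by (rule distributed_nn_integral[OF dist, symmetric])
         (intro borel_measurable_prod_ennreal, auto)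
    finally show ?thesis .
  qed
  also have "\<dots> = (\<integral>\<^sup>+y. ennreal (sqrt (8 * pi)) * (ennreal (exc_entrance (\<tau> 0) (y 1))
      * (\<Prod>k\<in>{1..n}. ennreal (killed_heat_kernel (\<tau> k) (y k) (y (Suc k))))
      * (\<Prod>k\<in>{1..?N}. ennreal (exp (- c k * y k))) * ennreal (exc_entrance ?a (y ?N))) \<partial>?P)"
  proof (rule nn_integral_cong)
    fix y :: "nat \<Rightarrow> real"
    have "(\<Prod>k\<in>{1..<?N}. killed_heat_kernel (u (Suc k) - u k) (y k) (y (Suc k)))
        = (\<Prod>k\<in>{1..n}. killed_heat_kernel (\<tau> k) (y k) (y (Suc k)))"
      by (rule prod.cong) (auto simp: \<tau>)
    moreover have "ennreal (\<Prod>k\<in>{1..n}. killed_heat_kernel (\<tau> k) (y k) (y (Suc k)))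
        = (\<Prod>k\<in>{1..n}. ennreal (killed_heat_kernel (\<tau> k) (y k) (y (Suc k))))"
      by (intro prod_ennreal[symmetric] killed_heat_kernel_nonneg \<tau>_pos) auto
    moreover have "0 \<le> (\<Prod>k\<in>{1..n}. killed_heat_kernel (\<tau> k) (y k) (y (Suc k)))"
      by (intro prod_nonneg killed_heat_kernel_nonneg \<tau>_pos) auto
    moreover have "0 \<le> exc_entrance (\<tau> 0) (y 1)" "0 \<le> exc_entrance ?a (y ?N)"
      using \<tau>_pos[of 0] \<open>0 < ?a\<close> by (auto intro: exc_entrance_nonneg)
    ultimately have "ennreal (excursion_density ?N u y) = ennreal (sqrt (8 * pi)) * (ennreal (exc_entrance (\<tau> 0) (y 1))
      * (\<Prod>k\<in>{1..n}. ennreal (killed_heat_kernel (\<tau> k) (y k) (y (Suc k)))) * ennreal (exc_entrance ?a (y ?N)))"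
      unfolding excursion_density_def by (simp add: ennreal_mult \<tau>(1) ac_simps)
    then show "ennreal (excursion_density ?N u y) * (\<Prod>k\<in>{1..?N}. ennreal (exp (- c k * y k)))
        = ennreal (sqrt (8 * pi)) * (ennreal (exc_entrance (\<tau> 0) (y 1))
      * (\<Prod>k\<in>{1..n}. ennreal (killed_heat_kernel (\<tau> k) (y k) (y (Suc k))))
      * (\<Prod>k\<in>{1..?N}. ennreal (exp (- c k * y k))) * ennreal (exc_entrance ?a (y ?N)))"
      by (simp only: ac_simps)
  qed
  also have "\<dots> = ennreal (sqrt (8 * pi)) * (\<integral>\<^sup>+y. ennreal (exc_entrance (\<tau> 0) (y 1))
      * (\<Prod>k\<in>{1..n}. ennreal (killed_heat_kernel (\<tau> k) (y k) (y (Suc k))))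
      * (\<Prod>k\<in>{1..?N}. ennreal (exp (- c k * y k))) * ennreal (exc_entrance ?a (y ?N)) \<partial>?P)"
    by (rule nn_integral_cmult) measurable
  also have "(\<integral>\<^sup>+y. ennreal (exc_entrance (\<tau> 0) (y 1))
      * (\<Prod>k\<in>{1..n}. ennreal (killed_heat_kernel (\<tau> k) (y k) (y (Suc k))))
      * (\<Prod>k\<in>{1..?N}. ennreal (exp (- c k * y k))) * ennreal (exc_entrance ?a (y ?N)) \<partial>?P)
    = (\<integral>\<^sup>+w. ennreal (sine_transform ?G w / (2 * pi)) * ennreal (exp (- c ?N * w)) * ennreal (exc_entrance ?a w) \<partial>half_line)"
    by (rule nn_integral_killed_paths) (use \<tau>_pos c in auto)
  also have "\<dots> = (\<integral>\<^sup>+w. ennreal (1 / (4 * pi\<^sup>2) * (sine_transform (\<lambda>x. exp (- ?a * x / 2)) w *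
      (exp (- c ?N * w) * sine_transform ?G w))) \<partial>half_line)"
  proof (rule nn_integral_half_line_cong)
    fix w :: real assume "0 < w"
    have S: "0 \<le> sine_transform ?G w"
      by (rule sine_transform_feynman_kac_nonneg) (use \<tau>_pos c \<open>0 < w\<close> in auto)
    show "ennreal (sine_transform ?G w / (2 * pi)) * ennreal (exp (- c ?N * w)) * ennreal (exc_entrance ?a w)
        = ennreal (1 / (4 * pi\<^sup>2) * (sine_transform (\<lambda>x. exp (- ?a * x / 2)) w * (exp (- c ?N * w) * sine_transform ?G w)))"
      unfolding sine_transform_exp[OF \<open>0 < ?a\<close> \<open>0 < w\<close>]
      using S exc_entrance_nonneg[OF \<open>0 < ?a\<close>, of w]
      by (simp add: power2_eq_square ac_simps flip: ennreal_mult')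
  qed
  also have "\<dots> = ennreal (\<integral>w. 1 / (4 * pi\<^sup>2) * (sine_transform (\<lambda>x. exp (- ?a * x / 2)) w *
      (exp (- c ?N * w) * sine_transform ?G w)) \<partial>half_line)"
  proof (rule nn_integral_eq_integral)
    show "integrable half_line (\<lambda>w. 1 / (4 * pi\<^sup>2) * (sine_transform (\<lambda>x. exp (- ?a * x / 2)) w *
      (exp (- c ?N * w) * sine_transform ?G w)))"
      by (intro integrable_mult_right sine_transform_parseval(1) integrable_exp_mult_half
          integrable_feynman_kac) (use \<open>0 < ?a\<close> \<open>0 < c ?N\<close> \<tau>_pos c in auto)
    show "AE w in half_line. 0 \<le> 1 / (4 * pi\<^sup>2) * (sine_transform (\<lambda>x. exp (- ?a * x / 2)) w *
      (exp (- c ?N * w) * sine_transform ?G w))"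
    proof (rule AE_half_lineI)
      fix w :: real assume "0 < w"
      then show "0 \<le> 1 / (4 * pi\<^sup>2) * (sine_transform (\<lambda>x. exp (- ?a * x / 2)) w *
      (exp (- c ?N * w) * sine_transform ?G w))"
        unfolding sine_transform_exp[OF \<open>0 < ?a\<close> \<open>0 < w\<close>]
        using exc_entrance_nonneg[OF \<open>0 < ?a\<close>, of w] sine_transform_feynman_kac_nonneg[of n \<tau> c w] \<tau>_pos c
        by (auto intro!: mult_nonneg_nonneg)
    qed
  qed
  also have "(\<integral>w. 1 / (4 * pi\<^sup>2) * (sine_transform (\<lambda>x. exp (- ?a * x / 2)) w *
      (exp (- c ?N * w) * sine_transform ?G w)) \<partial>half_line)
    = 1 / (4 * pi\<^sup>2) * (\<integral>y. exp (- ?a * y / 2) * (pi * sqrt y * (\<integral>x. trans_density (c ?N) y x * ?G x \<partial>half_line)) \<partial>half_line)"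
    by (subst integral_mult_right_zero,
        subst sine_transform_parseval(2)[OF \<open>0 < c ?N\<close> integrable_exp_mult_half[OF \<open>0 < ?a\<close>]])
       (use \<tau>_pos c in \<open>auto intro!: integrable_feynman_kac\<close>)
  also have "\<dots> = 1 / (4 * pi) * (\<integral>x. sqrt x * exp (- ?a * x / 2) * (\<integral>y. trans_density (c ?N) x y * ?G y \<partial>half_line) \<partial>half_line)"
  proof -
    have "(\<integral>y. exp (- ?a * y / 2) * (pi * sqrt y * (\<integral>x. trans_density (c ?N) y x * ?G x \<partial>half_line)) \<partial>half_line)
        = (\<integral>x. pi * (sqrt x * exp (- ?a * x / 2) * (\<integral>y. trans_density (c ?N) x y * ?G y \<partial>half_line)) \<partial>half_line)"
      by (simp only: ac_simps)
    also have "\<dots> = pi * (\<integral>x. sqrt x * exp (- ?a * x / 2) * (\<integral>y. trans_density (c ?N) x y * ?G y \<partial>half_line) \<partial>half_line)"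
      by (rule integral_mult_right_zero)
    finally show ?thesis by (simp add: power2_eq_square)
  qed
  also have "ennreal (sqrt (8 * pi)) * ennreal (1 / (4 * pi) *
      (\<integral>x. sqrt x * exp (- ?a * x / 2) * (\<integral>y. trans_density (c ?N) x y * ?G y \<partial>half_line) \<partial>half_line))
    = ennreal (\<integral>x. 1 / sqrt (2 * pi) * (sqrt x * exp (- ?a * x / 2) *
        (\<integral>y. trans_density (c ?N) x y * ?G y \<partial>half_line)) \<partial>half_line)"
  proof -
    have "sqrt (8 * pi) * (1 / (4 * pi)) = 1 / sqrt (2 * pi)"
    proof -
      have "sqrt (8 * pi) * sqrt (2 * pi) = sqrt ((4 * pi)\<^sup>2)"
        unfolding real_sqrt_mult[symmetric] by (simp add: power2_eq_square)
      also have "\<dots> = 4 * pi" by (subst real_sqrt_abs) simp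
      finally show ?thesis by (simp add: field_simps)
    qed
    then show ?thesis
      by (subst ennreal_mult'[symmetric]) (simp_all only: mult.assoc[symmetric] integral_mult_right_zero real_sqrt_ge_zero, simp_all)
  qed
  also have "\<dots> = (\<integral>\<^sup>+x. ennreal (1 / sqrt (2 * pi) * (sqrt x * exp (- ?a * x / 2) *
        (\<integral>y. trans_density (c ?N) x y * ?G y \<partial>half_line))) \<partial>half_line)"
  proof (rule nn_integral_eq_integral[symmetric])
    show "integrable half_line (\<lambda>x. 1 / sqrt (2 * pi) * (sqrt x * exp (- ?a * x / 2) *
        (\<integral>y. trans_density (c ?N) x y * ?G y \<partial>half_line)))"
      by (intro integrable_mult_right integrable_sqrt_exp_transition integrable_feynman_kac)
         (use \<open>0 < ?a\<close> \<open>0 < c ?N\<close> \<tau>_pos c in auto)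
    show "AE x in half_line. 0 \<le> 1 / sqrt (2 * pi) * (sqrt x * exp (- ?a * x / 2) *
        (\<integral>y. trans_density (c ?N) x y * ?G y \<partial>half_line))"
      using \<open>0 < c ?N\<close> c
      by (auto intro!: AE_half_lineI mult_nonneg_nonneg divide_nonneg_nonneg integral_nonneg_AE trans_density_nonneg feynman_kac_nonneg)
  qed
  finally show ?thesis .
qed

section \<open>The Feynman--Kac formula\<close>

context markov_process_from
begin

lemma finite_measure_subalgebra_natural_filtration:
  assumes "0 \<le> s"
  shows "finite_measure_subalgebra M (natural_filtration M X s)"
proof unfold_locales
  let ?G = "{X u -` A \<inter> space M | u A. 0 \<le> u \<and> u \<le> s \<and> A \<in> sets borel}"
  have "?G \<subseteq> sets M"
    using random_variable_X by (auto intro: measurable_sets)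
  then have "sigma_sets (space M) ?G \<subseteq> sets M"
    by (rule sets.sigma_sets_subset)
  moreover have "?G \<subseteq> Pow (space M)" by auto
  ultimately show "subalgebra M (natural_filtration M X s)"
    unfolding subalgebra_def natural_filtration_def by (simp add: space_measure_of_conv sets_measure_of)
qed

lemma measurable_natural_filtration:
  assumes "0 \<le> u" "u \<le> s"
  shows "X u \<in> borel_measurable (natural_filtration M X s)"
proof (rule measurableI)
  fix A :: "real set" assume "A \<in> sets borel"
  let ?G = "{X u -` A \<inter> space M | u A. 0 \<le> u \<and> u \<le> s \<and> A \<in> sets borel}"
  have "X u -` A \<inter> space M \<in> sigma_sets (space M) ?G"
    using assms \<open>A \<in> sets borel\<close> by (intro sigma_sets.Basic) auto
  moreover have "?G \<subseteq> Pow (space M)" by auto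
  ultimately show "X u -` A \<inter> space (natural_filtration M X s) \<in> sets (natural_filtration M X s)"
    unfolding natural_filtration_def by (simp add: space_measure_of_conv sets_measure_of)
qed simp

text \<open>Integrability of the transition density is a consequence of the Markov property: the set
  integral over the whole state space is almost surely one, hence not the default value zero of a
  function that is not integrable.\<close>

lemma AE_transition_density_integrable:
  assumes "0 \<le> s" "s < t"
  shows "AE \<omega> in M. set_integrable lborel {0..} (p (t - s) (X s \<omega>))"
proof -
  let ?F = "natural_filtration M X s"
  interpret F: finite_measure_subalgebra M ?F
    by (rule finite_measure_subalgebra_natural_filtration) fact
  have space: "space ?F = space M"
    using F.subalg by (simp add: subalgebra_def)
  have one: "indicator {0..} (X t \<omega>) = (1 :: real)" if "\<omega> \<in> space M" for \<omega>
    using state_space[of t \<omega>] assms that by simp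
  have "AE \<omega> in M. real_cond_exp M ?F (\<lambda>\<omega>. indicator {0..} (X t \<omega>)) \<omega> = indicator {0..} (X t \<omega>)"
  proof (rule F.real_cond_exp_F_meas)
    show "integrable M (\<lambda>\<omega>. indicator {0..} (X t \<omega>) :: real)"
      by (rule Bochner_Integration.integrable_cong[THEN iffD1, OF refl one[symmetric]]) auto
    show "(\<lambda>\<omega>. indicator {0..} (X t \<omega>) :: real) \<in> borel_measurable ?F"
      by (rule measurable_cong[THEN iffD1, OF one[symmetric]]) (auto simp: space)
  qed
  with markov[OF assms, of "{0..}"] have "AE \<omega> in M. (LINT y:{0..}|lborel. p (t - s) (X s \<omega>) y) = 1"
    using one by (auto elim!: AE_mp)
  then show ?thesis
    unfolding set_lebesgue_integral_def set_integrable_def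
    by eventually_elim (use not_integrable_integral_eq in fastforce)
qed

text \<open>The defining property of the conditional expectation, tested against the bounded variable \<open>Z\<close>
  of the past.\<close>

lemma nn_integral_markov_indicator:
  assumes [measurable]: "\<And>c. (\<lambda>(x, y). p c x y) \<in> borel_measurable (borel \<Otimes>\<^sub>M borel)"
    and p_nonneg: "\<And>c x y. 0 < c \<Longrightarrow> 0 \<le> x \<Longrightarrow> 0 \<le> y \<Longrightarrow> 0 \<le> p c x y"
    and "0 \<le> s" "s < t"
    and Z: "Z \<in> borel_measurable (natural_filtration M X s)" "\<And>\<omega>. 0 \<le> Z \<omega>" "\<And>\<omega>. Z \<omega> \<le> 1"
    and [measurable]: "A \<in> sets borel"
  shows "(\<integral>\<^sup>+\<omega>. ennreal (Z \<omega>) * indicator A (X t \<omega>) \<partial>M)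
    = (\<integral>\<^sup>+\<omega>. ennreal (Z \<omega>) * (\<integral>\<^sup>+y. ennreal (p (t - s) (X s \<omega>) y) * indicator A y \<partial>half_line) \<partial>M)"
proof -
  let ?F = "natural_filtration M X s" and ?p = "\<lambda>\<omega>. p (t - s) (X s \<omega>)"
  let ?A = "A \<inter> {0..}"
  have [measurable]: "random_variable borel (X t)" "random_variable borel (X s)"
    using assms by (auto intro: random_variable_X)
  interpret F: finite_measure_subalgebra M ?F
    by (rule finite_measure_subalgebra_natural_filtration) fact
  have [measurable]: "Z \<in> borel_measurable M"
    by (rule measurable_from_subalg[OF F.subalg Z(1)])
  have int: "integrable M (\<lambda>\<omega>. Z \<omega> * indicator ?A (X t \<omega>))"
    by (rule integrable_const_bound[where B = 1]) (use Z in \<open>auto simp: indicator_def\<close>)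
  have ce: "AE \<omega> in M. real_cond_exp M ?F (\<lambda>\<omega>. indicator ?A (X t \<omega>)) \<omega> = (LINT y:?A|lborel. ?p \<omega> y)"
    by (rule markov) (use assms in auto)
  have "(\<integral>\<^sup>+\<omega>. ennreal (Z \<omega>) * indicator A (X t \<omega>) \<partial>M) = (\<integral>\<^sup>+\<omega>. ennreal (Z \<omega> * indicator ?A (X t \<omega>)) \<partial>M)"
    using state_space[of t] assms by (intro nn_integral_cong) (auto simp: indicator_def)
  also have "\<dots> = ennreal (\<integral>\<omega>. Z \<omega> * indicator ?A (X t \<omega>) \<partial>M)"
    by (rule nn_integral_eq_integral[OF int]) (use Z in auto)
  also have "(\<integral>\<omega>. Z \<omega> * indicator ?A (X t \<omega>) \<partial>M)
      = (\<integral>\<omega>. Z \<omega> * real_cond_exp M ?F (\<lambda>\<omega>. indicator ?A (X t \<omega>)) \<omega> \<partial>M)"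
    by (rule F.real_cond_exp_intg(2)[OF int Z(1), symmetric]) measurable
  also have "\<dots> = (\<integral>\<omega>. Z \<omega> * (LINT y:?A|lborel. ?p \<omega> y) \<partial>M)"
    using ce by (intro integral_cong_AE) (auto simp: set_lebesgue_integral_def elim!: AE_mp)
  also have "ennreal \<dots> = (\<integral>\<^sup>+\<omega>. ennreal (Z \<omega> * (LINT y:?A|lborel. ?p \<omega> y)) \<partial>M)"
  proof (rule nn_integral_eq_integral[symmetric])
    have "integrable M (\<lambda>\<omega>. Z \<omega> * real_cond_exp M ?F (\<lambda>\<omega>. indicator ?A (X t \<omega>)) \<omega>)"
      by (rule F.real_cond_exp_intg(1)[OF int Z(1)]) measurable
    then show "integrable M (\<lambda>\<omega>. Z \<omega> * (LINT y:?A|lborel. ?p \<omega> y))"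
      using ce by (subst integrable_cong_AE[where g = "\<lambda>\<omega>. Z \<omega> * real_cond_exp M ?F (\<lambda>\<omega>. indicator ?A (X t \<omega>)) \<omega>"])
        (auto simp: set_lebesgue_integral_def elim!: AE_mp)
    show "AE \<omega> in M. 0 \<le> Z \<omega> * (LINT y:?A|lborel. ?p \<omega> y)"
      using state_space[of s] assms
      unfolding set_lebesgue_integral_def
      by (intro AE_I2 mult_nonneg_nonneg Z integral_nonneg) (auto simp: indicator_def intro!: p_nonneg)
  qed
  also have "\<dots> = (\<integral>\<^sup>+\<omega>. ennreal (Z \<omega>) * (\<integral>\<^sup>+y. ennreal (?p \<omega> y) * indicator A y \<partial>half_line) \<partial>M)"
  proof (rule nn_integral_cong_AE)
    show "AE \<omega> in M. ennreal (Z \<omega> * (LINT y:?A|lborel. ?p \<omega> y))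
        = ennreal (Z \<omega>) * (\<integral>\<^sup>+y. ennreal (?p \<omega> y) * indicator A y \<partial>half_line)"
      using AE_transition_density_integrable[OF assms(3,4)] AE_space
    proof eventually_elim
      fix \<omega> assume int: "set_integrable lborel {0..} (?p \<omega>)" and "\<omega> \<in> space M"
      have p0: "0 \<le> ?p \<omega> y" if "0 \<le> y" for y
        using that assms state_space[of s \<omega>] \<open>\<omega> \<in> space M\<close> by (intro p_nonneg) auto
      have "set_integrable lborel ?A (?p \<omega>)"
        by (rule set_integrable_subset[OF int]) auto
      then have "ennreal (LINT y:?A|lborel. ?p \<omega> y) = (\<integral>\<^sup>+y. ennreal (indicator ?A y * ?p \<omega> y) \<partial>lborel)"
        unfolding set_integrable_def set_lebesgue_integral_def using p0
        by (subst nn_integral_eq_integral) (auto simp: indicator_def)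
      also have "\<dots> = (\<integral>\<^sup>+y. indicator {0<..} y * (ennreal (?p \<omega> y) * indicator A y) \<partial>lborel)"
      proof (rule nn_integral_cong_AE)
        show "AE y in lborel. ennreal (indicator ?A y * ?p \<omega> y) = indicator {0<..} y * (ennreal (?p \<omega> y) * indicator A y)"
          using AE_lborel_singleton[of "0 :: real"] by eventually_elim (auto simp: indicator_def)
      qed
      also have "\<dots> = (\<integral>\<^sup>+y. ennreal (?p \<omega> y) * indicator A y \<partial>half_line)"
        by (rule nn_integral_half_line[symmetric]) measurable
      finally show "ennreal (Z \<omega> * (LINT y:?A|lborel. ?p \<omega> y))
        = ennreal (Z \<omega>) * (\<integral>\<^sup>+y. ennreal (?p \<omega> y) * indicator A y \<partial>half_line)"
        by (simp add: ennreal_mult' Z)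
    qed
  qed
  finally show ?thesis .
qed

text \<open>For fixed \<open>Z\<close>, either side is the integral of \<open>f\<close> with respect to a measure that does not depend on
  \<open>f\<close>. The two measures agree on Borel sets by the indicator case.\<close>

lemma nn_integral_markov:
  assumes p[measurable]: "\<And>c. (\<lambda>(x, y). p c x y) \<in> borel_measurable (borel \<Otimes>\<^sub>M borel)"
    and p_nonneg: "\<And>c x y. 0 < c \<Longrightarrow> 0 \<le> x \<Longrightarrow> 0 \<le> y \<Longrightarrow> 0 \<le> p c x y"
    and "0 \<le> s" "s < t"
    and Z: "Z \<in> borel_measurable (natural_filtration M X s)" "\<And>\<omega>. 0 \<le> Z \<omega>" "\<And>\<omega>. Z \<omega> \<le> 1"
    and f[measurable]: "f \<in> borel_measurable borel"
  shows "(\<integral>\<^sup>+\<omega>. ennreal (Z \<omega>) * f (X t \<omega>) \<partial>M)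
    = (\<integral>\<^sup>+\<omega>. ennreal (Z \<omega>) * (\<integral>\<^sup>+y. ennreal (p (t - s) (X s \<omega>) y) * f y \<partial>half_line) \<partial>M)"
proof -
  have [measurable]: "random_variable borel (X t)" "random_variable borel (X s)"
    using assms by (auto intro: random_variable_X)
  have [measurable]: "Z \<in> borel_measurable M"
    using finite_measure_subalgebra_natural_filtration[OF \<open>0 \<le> s\<close>]
    by (intro measurable_from_subalg[OF _ Z(1)]) (simp add: finite_measure_subalgebra_def finite_measure_subalgebra_axioms_def)
  interpret pair_sigma_finite half_line M ..
  let ?p = "\<lambda>\<omega> y. ennreal (p (t - s) (X s \<omega>) y)"
  have swap: "(\<integral>\<^sup>+\<omega>. ennreal (Z \<omega>) * (\<integral>\<^sup>+y. ?p \<omega> y * g y \<partial>half_line) \<partial>M)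
      = (\<integral>\<^sup>+y. (\<integral>\<^sup>+\<omega>. ennreal (Z \<omega>) * ?p \<omega> y \<partial>M) * g y \<partial>half_line)"
    if [measurable]: "g \<in> borel_measurable borel" for g
  proof -
    have "(\<integral>\<^sup>+\<omega>. ennreal (Z \<omega>) * (\<integral>\<^sup>+y. ?p \<omega> y * g y \<partial>half_line) \<partial>M)
        = (\<integral>\<^sup>+\<omega>. (\<integral>\<^sup>+y. ennreal (Z \<omega>) * ?p \<omega> y * g y \<partial>half_line) \<partial>M)"
      by (subst nn_integral_cmult[symmetric]) (auto simp: mult.assoc)
    also have "\<dots> = (\<integral>\<^sup>+y. (\<integral>\<^sup>+\<omega>. ennreal (Z \<omega>) * ?p \<omega> y * g y \<partial>M) \<partial>half_line)"
      by (rule Fubini') measurable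
    also have "\<dots> = (\<integral>\<^sup>+y. (\<integral>\<^sup>+\<omega>. ennreal (Z \<omega>) * ?p \<omega> y \<partial>M) * g y \<partial>half_line)"
      by (subst nn_integral_multc) auto
    finally show ?thesis .
  qed
  have "distr (density M (\<lambda>\<omega>. ennreal (Z \<omega>))) borel (X t)
      = density half_line (\<lambda>y. \<integral>\<^sup>+\<omega>. ennreal (Z \<omega>) * ?p \<omega> y \<partial>M)" (is "?N1 = ?N2")
  proof (rule measure_eqI)
    fix A assume "A \<in> sets ?N1"
    then have [measurable]: "A \<in> sets borel" by simp
    have "emeasure ?N1 A = (\<integral>\<^sup>+\<omega>. ennreal (Z \<omega>) * indicator (X t -` A \<inter> space M) \<omega> \<partial>M)"
      by (subst emeasure_distr) (auto simp: emeasure_density)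
    also have "\<dots> = (\<integral>\<^sup>+\<omega>. ennreal (Z \<omega>) * indicator A (X t \<omega>) \<partial>M)"
      by (rule nn_integral_cong) (auto simp: indicator_def)
    also have "\<dots> = (\<integral>\<^sup>+\<omega>. ennreal (Z \<omega>) * (\<integral>\<^sup>+y. ?p \<omega> y * indicator A y \<partial>half_line) \<partial>M)"
      by (rule nn_integral_markov_indicator[OF p p_nonneg assms(3,4) Z]) measurable
    also have "\<dots> = emeasure ?N2 A"
      by (simp add: swap emeasure_density)
    finally show "emeasure ?N1 A = emeasure ?N2 A" .
  qed simp
  then have "(\<integral>\<^sup>+y. f y \<partial>?N1) = (\<integral>\<^sup>+y. f y \<partial>?N2)" by simp
  then show ?thesis
    by (simp add: swap nn_integral_distr nn_integral_density)
qed

end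

lemma nn_integral_trans_density_feynman_kac:
  assumes "\<And>k. k \<le> n \<Longrightarrow> 0 < \<tau> k" "\<And>k. k \<in> {1..Suc n} \<Longrightarrow> 0 < c k" "0 \<le> x"
  shows "(\<integral>\<^sup>+y. ennreal (trans_density (c (Suc n)) x y) * ennreal (feynman_kac \<tau> c n y) \<partial>half_line)
    = ennreal (\<integral>y. trans_density (c (Suc n)) x y * feynman_kac \<tau> c n y \<partial>half_line)"
proof -
  have "(\<integral>\<^sup>+y. ennreal (trans_density (c (Suc n)) x y) * ennreal (feynman_kac \<tau> c n y) \<partial>half_line)
      = (\<integral>\<^sup>+y. ennreal (trans_density (c (Suc n)) x y * feynman_kac \<tau> c n y) \<partial>half_line)"
    using assms by (intro nn_integral_half_line_cong ennreal_mult[symmetric] trans_density_nonneg feynman_kac_nonneg) auto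
  also have "\<dots> = ennreal (\<integral>y. trans_density (c (Suc n)) x y * feynman_kac \<tau> c n y \<partial>half_line)"
    using assms
    by (intro nn_integral_eq_integral integrable_trans_density_mult(1) integrable_feynman_kac
        AE_half_lineI mult_nonneg_nonneg trans_density_nonneg feynman_kac_nonneg) auto
  finally show ?thesis .
qed

text \<open>The times are removed one by one from the last to the first; after \<open>r\<close> steps the factors that
  belong to the last times are replaced by \<open>feynman_kac \<tau> c r\<close>, evaluated at the
  last time that is left. Positivity of the later weights makes each
  function integrable before the next transition is applied to it.\<close>

lemma feynman_kac_formula:
  fixes s w \<tau> c :: "nat \<Rightarrow> real"
  assumes "markov_process_from trans_density M X x"
    and s: "s 0 = 0" "\<And>k. k < d \<Longrightarrow> s k < s (Suc k)"
    and w: "\<And>k. k \<in> {1..d} \<Longrightarrow> 0 < w k" "0 \<le> w 0"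
    and \<tau>: "\<And>j. j \<le> d \<Longrightarrow> \<tau> j = w (d - j)"
    and c: "\<And>j. j \<in> {1..d} \<Longrightarrow> c j = s (Suc d - j) - s (d - j)"
  shows "(\<integral>\<^sup>+\<omega>. ennreal (exp (- (1 / 2) * (\<Sum>k=0..d. w k * X (s k) \<omega>))) \<partial>M) = ennreal (feynman_kac \<tau> c d x)"
proof -
  interpret markov_process_from trans_density M X x by fact
  have s_mono: "s k \<le> s m" if "k \<le> m" "m \<le> d" for k m
    by (rule increasing_on_interval_le[of 0 d]) (use that s(2) in \<open>auto intro: less_imp_le\<close>)
  have s_nonneg: "0 \<le> s k" if "k \<le> d" for k
    using s_mono[of 0 k] that s by simp
  have c_pos: "0 < c j" if "j \<in> {1..d}" for j
    using s(2)[of "d - j"] c[OF that] that by (simp add: Suc_diff_le)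
  have \<tau>_pos: "0 < \<tau> j" if "j < d" for j
    using that \<tau>[of j] w(1)[of "d - j"] by auto
  have w_nonneg: "0 \<le> w k" if "k \<le> d" for k
    using w(1)[of k] w(2) that by (cases k) (auto intro: less_imp_le)
  let ?e = "\<lambda>k \<omega>. exp (- w k * X (s k) \<omega> / 2)"
  have rv[measurable]: "random_variable borel (X (s k))" if "k \<le> d" for k
    using s_nonneg[OF that] by (rule random_variable_X)
  have X_nonneg: "0 \<le> X (s k) \<omega>" if "k \<le> d" "\<omega> \<in> space M" for k \<omega>
    using state_space[OF s_nonneg[OF that(1)] that(2)] by simp
  have step: "(\<integral>\<^sup>+\<omega>. ennreal (\<Prod>k<d. ?e k \<omega>) * ennreal (feynman_kac \<tau> c 0 (X (s d) \<omega>)) \<partial>M)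
      = (\<integral>\<^sup>+\<omega>. ennreal (\<Prod>k<d - r. ?e k \<omega>) * ennreal (feynman_kac \<tau> c r (X (s (d - r)) \<omega>)) \<partial>M)"
    if "r \<le> d" for r
    using that
  proof (induction r)
    case (Suc r)
    define m where "m = d - Suc r"
    have dr: "d - r = Suc m" "m < d" "m \<le> d" using Suc.prems by (auto simp: m_def)
    (* The Markov property is applied with a factor bounded by 1 everywhere. The truncation is without
       effect on the sample space, where X and the weights are nonnegative. *)
    define Z where "Z = (\<lambda>\<omega>. min 1 (\<Prod>k<Suc m. ?e k \<omega>))"
    have Z: "Z \<omega> = (\<Prod>k<Suc m. ?e k \<omega>)" if "\<omega> \<in> space M" for \<omega>
      unfolding Z_def using that dr
      by (intro min_absorb2 prod_le_1) (auto intro!: mult_nonneg_nonneg w_nonneg X_nonneg)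
    have Z01: "0 \<le> Z \<omega>" "Z \<omega> \<le> 1" for \<omega>
      by (auto simp: Z_def intro!: prod_nonneg simp del: prod.lessThan_Suc)
    have Z_meas: "Z \<in> borel_measurable (natural_filtration M X (s m))"
    proof -
      have "(\<lambda>\<omega>. \<Prod>k<Suc m. ?e k \<omega>) \<in> borel_measurable (natural_filtration M X (s m))"
      proof (rule borel_measurable_prod)
        fix k assume "k \<in> {..<Suc m}"
        then have [measurable]: "X (s k) \<in> borel_measurable (natural_filtration M X (s m))"
          using dr by (intro measurable_natural_filtration s_nonneg s_mono) auto
        show "?e k \<in> borel_measurable (natural_filtration M X (s m))" by measurable
      qed
      then show ?thesis unfolding Z_def by measurable
    qed
    have c_eq: "c (Suc r) = s (Suc m) - s m"
      using c[of "Suc r"] Suc.prems dr by (simp add: m_def)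
    have \<tau>_eq: "\<tau> (Suc r) = w m"
      using \<tau>[of "Suc r"] Suc.prems by (simp add: m_def)
    have "(\<integral>\<^sup>+\<omega>. ennreal (\<Prod>k<d - r. ?e k \<omega>) * ennreal (feynman_kac \<tau> c r (X (s (d - r)) \<omega>)) \<partial>M)
        = (\<integral>\<^sup>+\<omega>. ennreal (Z \<omega>) * ennreal (feynman_kac \<tau> c r (X (s (Suc m)) \<omega>)) \<partial>M)"
      unfolding dr by (rule nn_integral_cong) (simp only: Z)
    also have "\<dots> = (\<integral>\<^sup>+\<omega>. ennreal (Z \<omega>) * (\<integral>\<^sup>+y. ennreal (trans_density (s (Suc m) - s m) (X (s m) \<omega>) y) *
        ennreal (feynman_kac \<tau> c r y) \<partial>half_line) \<partial>M)"
      using s(2)[of m] dr s_nonneg[of m]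
      by (intro nn_integral_markov[OF measurable_trans_density trans_density_nonneg _ _ Z_meas Z01]) auto
    also have "\<dots> = (\<integral>\<^sup>+\<omega>. ennreal (\<Prod>k<d - Suc r. ?e k \<omega>) * ennreal (feynman_kac \<tau> c (Suc r) (X (s (d - Suc r)) \<omega>)) \<partial>M)"
      unfolding m_def[symmetric]
    proof (rule nn_integral_cong)
      fix \<omega> assume \<omega>: "\<omega> \<in> space M"
      let ?I = "\<integral>y. trans_density (c (Suc r)) (X (s m) \<omega>) y * feynman_kac \<tau> c r y \<partial>half_line"
      have "(\<integral>\<^sup>+y. ennreal (trans_density (c (Suc r)) (X (s m) \<omega>) y) * ennreal (feynman_kac \<tau> c r y) \<partial>half_line) = ennreal ?I"
        by (rule nn_integral_trans_density_feynman_kac) (use Suc.prems \<tau>_pos c_pos X_nonneg[OF dr(3) \<omega>] in auto)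
      moreover have "ennreal (Z \<omega>) * ennreal ?I = ennreal (\<Prod>k<m. ?e k \<omega>) * ennreal (?e m \<omega> * ?I)"
        unfolding Z[OF \<omega>] by (simp add: ennreal_mult' prod_nonneg mult.assoc)
      ultimately show "ennreal (Z \<omega>) * (\<integral>\<^sup>+y. ennreal (trans_density (s (Suc m) - s m) (X (s m) \<omega>) y) *
        ennreal (feynman_kac \<tau> c r y) \<partial>half_line)
          = ennreal (\<Prod>k<m. ?e k \<omega>) * ennreal (feynman_kac \<tau> c (Suc r) (X (s m) \<omega>))"
        by (simp add: c_eq \<tau>_eq)
    qed
    finally show ?case using Suc by simp
  qed simp
  have "(\<integral>\<^sup>+\<omega>. ennreal (exp (- (1 / 2) * (\<Sum>k=0..d. w k * X (s k) \<omega>))) \<partial>M)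
      = (\<integral>\<^sup>+\<omega>. ennreal (\<Prod>k<d. ?e k \<omega>) * ennreal (feynman_kac \<tau> c 0 (X (s d) \<omega>)) \<partial>M)"
  proof (rule nn_integral_cong)
    fix \<omega>
    have "exp (- (1 / 2) * (\<Sum>k=0..d. w k * X (s k) \<omega>)) = exp (\<Sum>k\<in>{..<Suc d}. - w k * X (s k) \<omega> / 2)"
      by (simp add: sum_distrib_left atLeast0AtMost lessThan_Suc_atMost)
    also have "\<dots> = (\<Prod>k<Suc d. ?e k \<omega>)"
      by (rule exp_sum) simp
    finally show "ennreal (exp (- (1 / 2) * (\<Sum>k=0..d. w k * X (s k) \<omega>)))
        = ennreal (\<Prod>k<d. ?e k \<omega>) * ennreal (feynman_kac \<tau> c 0 (X (s d) \<omega>))"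
      using \<tau>[of 0] by (simp add: ennreal_mult' prod_nonneg)
  qed
  also have "\<dots> = (\<integral>\<^sup>+\<omega>. ennreal (feynman_kac \<tau> c d (X 0 \<omega>)) \<partial>M)"
    using step[of d] s by simp
  also have "\<dots> = (\<integral>\<^sup>+\<omega>. ennreal (feynman_kac \<tau> c d x) \<partial>M)"
    using initial_state by (intro nn_integral_cong_AE) auto
  finally show ?thesis by (simp add: emeasure_space_1)
qed

section \<open>Excursions of fixed length\<close>

text \<open>The excursion runs through the times \<open>v (1 - t k)\<close> with \<open>k\<close> decreasing, and the recursion for
  \<open>X\<close> starts at the last time \<open>s d\<close>; both therefore use the increments of \<open>t\<close> and \<open>s\<close> in
  reverse order.\<close>

definition rev_increment :: "nat \<Rightarrow> (nat \<Rightarrow> real) \<Rightarrow> nat \<Rightarrow> real" where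
  "rev_increment d f j = f (Suc d - j) - f (d - j)"

lemma rev_increment_pos:
  assumes "\<And>k. k \<in> {d - j..<Suc d - j} \<Longrightarrow> f k < f (Suc k)" "j \<le> d"
  shows "0 < rev_increment d f j"
  using assms(1)[of "d - j"] assms(2) by (simp add: rev_increment_def Suc_diff_le)

text \<open>The one-dimensional density vanishes on the negative reals. Nonnegativity provides the
  dominating constant one in the limit at the right end of the excursion.\<close>

lemma (in brownian_excursion) AE_excursion_nonneg:
  assumes "r \<in> {0..1}"
  shows "AE \<omega> in M. 0 \<le> B r \<omega>"
proof (cases "0 < r \<and> r < 1")
  case True
  let ?P = "\<Pi>\<^sub>M k\<in>{1::nat..1}. lborel :: real measure"
  have [measurable]: "random_variable borel (B r)" using random_variable_B assms by auto
  have dist: "distributed M ?P (\<lambda>\<omega>. \<lambda>k\<in>{1::nat..1}. B r \<omega>) (\<lambda>y. ennreal (excursion_density 1 (\<lambda>_. r) y))"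
    using joint_density[of 1 "\<lambda>_. r"] True by simp
  have "(\<integral>\<^sup>+\<omega>. indicator {..<0} (B r \<omega>) \<partial>M) = (\<integral>\<^sup>+\<omega>. indicator {..<0} ((\<lambda>k\<in>{1::nat..1}. B r \<omega>) 1) \<partial>M)"
    by simp
  also have "\<dots> = (\<integral>\<^sup>+y. ennreal (excursion_density 1 (\<lambda>_. r) y) * indicator {..<0} (y 1) \<partial>?P)"
    by (rule distributed_nn_integral[OF dist, symmetric]) measurable
  also have "\<dots> = (\<integral>\<^sup>+y. 0 \<partial>?P)"
    by (rule nn_integral_cong) (auto simp: excursion_density_def exc_entrance_def indicator_def)
  finally have "(\<integral>\<^sup>+\<omega>. indicator {..<0} (B r \<omega>) \<partial>M) = (0 :: ennreal)" by simp
  then have "AE \<omega> in M. indicator {..<0} (B r \<omega>) = (0 :: ennreal)"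
    by (subst (asm) nn_integral_0_iff_AE) auto
  then show ?thesis
    by eventually_elim (auto simp: indicator_def split: if_splits)
next
  case False
  then have "r = 0 \<or> r = 1" using assms by auto
  then show ?thesis using B_0 B_1 by (intro AE_I2) auto
qed

text \<open>The excursion is used at the times \<open>v (1 - t k)\<close>, in increasing order, with coefficients divided
  by \<open>\<surd>v\<close>. The scaling of the recursion and the substitution \<open>x \<mapsto> v x\<close> then leave \<open>v\<close> only in a
  factor in front of a recursion that does not depend on \<open>v\<close>.\<close>

lemma rescaled_excursion_laplace_interior:
  fixes s t :: "nat \<Rightarrow> real"
  assumes "brownian_excursion M B"
    and s: "\<And>k. k \<le> n \<Longrightarrow> s k < s (Suc k)"
    and t: "0 = t 0" "t 0 \<le> t 1" "\<And>k. k \<in> {1..Suc n} \<Longrightarrow> t k < t (Suc k)" "t (Suc (Suc n)) = 1"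
    and v: "0 < v" "v * (1 - t 1) < 1"
  shows "(\<integral>\<^sup>+\<omega>. ennreal (exp (- (\<Sum>k=1..Suc n. (s k - s (k - 1)) * (v powr (- 1 / 2) * B (v * (1 - t k)) \<omega>)))) \<partial>M)
    = (\<integral>\<^sup>+x. ennreal (v powr (- 3 / 2) / sqrt (2 * pi) * (sqrt x * exp (- (1 / v - 1) * x / 2) *
        feynman_kac (rev_increment (Suc n) t) (rev_increment (Suc n) s) (Suc n) x)) \<partial>half_line)"
proof -
  interpret brownian_excursion M B by fact
  let ?N = "Suc n" and ?\<tau> = "rev_increment (Suc n) t" and ?c = "rev_increment (Suc n) s"
  let ?u = "\<lambda>j. v * (1 - t (Suc ?N - j))" and ?c' = "\<lambda>j. ?c j / sqrt v" and ?\<tau>' = "\<lambda>j. v * ?\<tau> j"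
  have sum: "(\<Sum>k=1..?N. (s k - s (k - 1)) * (v powr (- 1 / 2) * B (v * (1 - t k)) \<omega>))
      = (\<Sum>j=1..?N. ?c' j * B (?u j) \<omega>)" for \<omega>
  proof (rule sum.reindex_bij_witness[of _ "\<lambda>j. Suc ?N - j" "\<lambda>k. Suc ?N - k"])
    fix k assume "k \<in> {1..?N}"
    then have "Suc ?N - (Suc ?N - k) = k" "?N - (Suc ?N - k) = k - 1" by auto
    moreover have "v powr (- 1 / 2) = 1 / sqrt v"
      using v by (simp add: powr_minus powr_half_sqrt inverse_eq_divide)
    ultimately show "?c' (Suc ?N - k) * B (?u (Suc ?N - k)) \<omega>
        = (s k - s (k - 1)) * (v powr (- 1 / 2) * B (v * (1 - t k)) \<omega>)"
      by (simp add: rev_increment_def)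
  qed auto
  have "(\<integral>\<^sup>+\<omega>. ennreal (exp (- (\<Sum>j=1..?N. ?c' j * B (?u j) \<omega>))) \<partial>M)
    = (\<integral>\<^sup>+x. ennreal (1 / sqrt (2 * pi) * (sqrt x * exp (- (1 - ?u ?N) * x / 2) *
        (\<integral>y. trans_density (?c' ?N) x y * feynman_kac ?\<tau>' ?c' n y \<partial>half_line))) \<partial>half_line)"
  proof (rule excursion_laplace_transform)
    show "0 < ?u 1" using v t(3)[of ?N] t(4) by simp
    show "?u ?N < 1" using v by simp
    show "?u k < ?u (Suc k)" if "k \<in> {1..n}" for k
    proof -
      have "Suc (Suc ?N - Suc k) = Suc ?N - k" using that by auto
      moreover have "t (Suc ?N - Suc k) < t (Suc (Suc ?N - Suc k))"
        using that by (intro t(3)) auto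
      ultimately show ?thesis using v by simp
    qed
    show "0 < ?c' k" if "k \<in> {1..?N}" for k
      using that v by (intro divide_pos_pos rev_increment_pos s) auto
    show "?\<tau>' 0 = ?u 1" using t by (simp add: rev_increment_def)
    show "?\<tau>' k = ?u (Suc k) - ?u k" if "k \<in> {1..n}" for k
      using that by (simp add: rev_increment_def algebra_simps)
  qed
  also have "\<dots> = (\<integral>\<^sup>+x. ennreal (1 / sqrt (2 * pi) * (sqrt x * exp (- (1 - v) * x / 2) * feynman_kac ?\<tau> ?c ?N (v * x))) \<partial>half_line)"
  proof (rule nn_integral_half_line_cong)
    fix x :: real assume "0 < x"
    have \<tau>': "?\<tau>' ?N = v * t 1" using t by (simp add: rev_increment_def)
    have "exp (- (1 - ?u ?N) * x / 2) = exp (- (1 - v) * x / 2) * exp (- ?\<tau>' ?N * x / 2)"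
      unfolding \<tau>' by (simp flip: exp_add) (simp add: algebra_simps add_divide_distrib[symmetric])
    then have "sqrt x * exp (- (1 - ?u ?N) * x / 2) *
        (\<integral>y. trans_density (?c' ?N) x y * feynman_kac ?\<tau>' ?c' n y \<partial>half_line)
      = sqrt x * exp (- (1 - v) * x / 2) * feynman_kac ?\<tau>' ?c' ?N x"
      by simp
    also have "feynman_kac ?\<tau>' ?c' ?N x = feynman_kac ?\<tau> ?c ?N (v * x)"
      using v \<open>0 < x\<close> by (intro feynman_kac_scale) auto
    finally show "ennreal (1 / sqrt (2 * pi) * (sqrt x * exp (- (1 - ?u ?N) * x / 2) *
        (\<integral>y. trans_density (?c' ?N) x y * feynman_kac ?\<tau>' ?c' n y \<partial>half_line)))
      = ennreal (1 / sqrt (2 * pi) * (sqrt x * exp (- (1 - v) * x / 2) * feynman_kac ?\<tau> ?c ?N (v * x)))"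
      by (simp only:)
  qed
  also have "\<dots> = (\<integral>\<^sup>+x. ennreal v * ennreal (v powr (- 3 / 2) / sqrt (2 * pi) * (sqrt (v * x) * exp (- (1 / v - 1) * (v * x) / 2) *
        feynman_kac ?\<tau> ?c ?N (v * x))) \<partial>half_line)"
  proof (rule nn_integral_half_line_cong)
    fix x :: real
    have "v * v powr (- 3 / 2) * sqrt v = v powr (1 + - 3 / 2 + 1 / 2)"
      using v unfolding powr_add by (simp add: powr_half_sqrt)
    then have pw: "v * v powr (- 3 / 2) * sqrt v = 1" using v by simp
    have ex: "- (1 / v - 1) * (v * x) / 2 = - (1 - v) * x / 2"
      using v by (simp add: field_simps)
    have "1 / sqrt (2 * pi) * (sqrt x * exp (- (1 - v) * x / 2) * feynman_kac ?\<tau> ?c ?N (v * x))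
      = (v * v powr (- 3 / 2) * sqrt v) / sqrt (2 * pi) * (sqrt x * exp (- (1 - v) * x / 2) * feynman_kac ?\<tau> ?c ?N (v * x))"
      unfolding pw ..
    also have "\<dots> = v * (v powr (- 3 / 2) / sqrt (2 * pi) * (sqrt (v * x) * exp (- (1 / v - 1) * (v * x) / 2) * feynman_kac ?\<tau> ?c ?N (v * x)))"
      unfolding ex real_sqrt_mult[of v] by (simp only: times_divide_eq_left times_divide_eq_right ac_simps)
    finally show "ennreal (1 / sqrt (2 * pi) * (sqrt x * exp (- (1 - v) * x / 2) * feynman_kac ?\<tau> ?c ?N (v * x)))
      = ennreal v * ennreal (v powr (- 3 / 2) / sqrt (2 * pi) * (sqrt (v * x) * exp (- (1 / v - 1) * (v * x) / 2) * feynman_kac ?\<tau> ?c ?N (v * x)))"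
      using v by (simp only: ennreal_mult'[symmetric] less_imp_le)
  qed
  also have "\<dots> = ennreal v * (\<integral>\<^sup>+x. ennreal (v powr (- 3 / 2) / sqrt (2 * pi) * (sqrt (v * x) * exp (- (1 / v - 1) * (v * x) / 2) *
        feynman_kac ?\<tau> ?c ?N (v * x))) \<partial>half_line)"
    by (rule nn_integral_cmult) measurable
  also have "\<dots> = (\<integral>\<^sup>+x. ennreal (v powr (- 3 / 2) / sqrt (2 * pi) * (sqrt x * exp (- (1 / v - 1) * x / 2) *
        feynman_kac ?\<tau> ?c ?N x)) \<partial>half_line)"
    using v by (intro nn_integral_half_line_scale[symmetric, of "\<lambda>x. ennreal (v powr (- 3 / 2) / sqrt (2 * pi) * (sqrt x * exp (- (1 / v - 1) * x / 2) *
        feynman_kac ?\<tau> ?c ?N x))"]) measurable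
  finally show ?thesis unfolding sum .
qed

text \<open>The right end of the excursion is approached along \<open>v \<rightarrow> 1\<close>. On the left the paths are continuous
  and the exponentials are bounded by one. On the right the integrands increase, since
  \<open>1 / v - 1\<close> decreases to zero, so monotone convergence applies although the limiting
  integrand has lost this exponential factor.\<close>

lemma rescaled_excursion_laplace_endpoint:
  fixes s t :: "nat \<Rightarrow> real"
  assumes "brownian_excursion M B"
    and s: "\<And>k. k \<le> n \<Longrightarrow> s k < s (Suc k)"
    and t: "0 = t 0" "0 = t 1" "\<And>k. k \<in> {1..Suc n} \<Longrightarrow> t k < t (Suc k)" "t (Suc (Suc n)) = 1"
  shows "(\<integral>\<^sup>+\<omega>. ennreal (exp (- (\<Sum>k=1..Suc n. (s k - s (k - 1)) * B (1 - t k) \<omega>))) \<partial>M)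
    = (\<integral>\<^sup>+x. ennreal (1 / sqrt (2 * pi) * (sqrt x *
        feynman_kac (rev_increment (Suc n) t) (rev_increment (Suc n) s) (Suc n) x)) \<partial>half_line)"
proof -
  interpret brownian_excursion M B by fact
  let ?W = "feynman_kac (rev_increment (Suc n) t) (rev_increment (Suc n) s) (Suc n)"
  define v where "v = (\<lambda>i. 1 - 1 / real (i + 2))"
  have v: "0 < v i" "v i < 1" for i by (auto simp: v_def field_simps)
  have v_mono: "v i \<le> v j" if "i \<le> j" for i j
    using that unfolding v_def by (intro diff_left_mono divide_left_mono) auto
  have v_lim: "v \<longlonglongrightarrow> 1" unfolding v_def by real_asymp
  have t_range: "0 \<le> t k \<and> t k \<le> 1" if "k \<in> {1..Suc n}" for k
  proof -
    have "t 1 \<le> t k" "t k \<le> t (Suc (Suc n))"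
      by (rule increasing_on_interval_le[of 1 "Suc (Suc n)"]; use that t(3) in \<open>auto intro: less_imp_le\<close>)+
    then show ?thesis using t by simp
  qed
  have range: "v i * (1 - t k) \<in> {0..1}" if "k \<in> {1..Suc n}" for i k
    using t_range[OF that] v[of i] by (auto intro!: mult_le_one)
  define f where "f = (\<lambda>i \<omega>. exp (- (\<Sum>k=1..Suc n. (s k - s (k - 1)) * (v i powr (- 1 / 2) * B (v i * (1 - t k)) \<omega>))))"
  (* The indicator makes the sequence monotone on the whole line, as the monotone limit theorem asks. *)
  define h where "h = (\<lambda>i x. ennreal (indicator {0<..} x * (sqrt x * exp (- (1 / v i - 1) * x / 2) * ?W x)))"
  have W: "0 \<le> ?W x" if "0 < x" for x
    using that by (intro feynman_kac_nonneg rev_increment_pos s) auto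
  have s_pos: "0 \<le> s k - s (k - 1)" if "k \<in> {1..Suc n}" for k
  proof -
    have "s (k - 1) < s (Suc (k - 1))" using that by (intro s) auto
    then show ?thesis using that by simp
  qed
  have B_meas: "random_variable borel (B (v i * (1 - t k)))" "random_variable borel (B (1 - t k))"
    if "k \<in> {1..Suc n}" for i k
    using range[OF that] t_range[OF that] by (auto intro!: random_variable_B)
  have "(\<lambda>i. \<integral>\<^sup>+\<omega>. ennreal (f i \<omega>) \<partial>M)
      \<longlonglongrightarrow> (\<integral>\<^sup>+\<omega>. ennreal (exp (- (\<Sum>k=1..Suc n. (s k - s (k - 1)) * B (1 - t k) \<omega>))) \<partial>M)"
  proof (rule nn_integral_dominated_convergence[where w = "\<lambda>_. 1"])
    show "(\<lambda>\<omega>. ennreal (f i \<omega>)) \<in> borel_measurable M" for i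
      unfolding f_def using B_meas
      by (intro measurable_compose[OF _ measurable_ennreal] borel_measurable_exp borel_measurable_uminus
          borel_measurable_sum borel_measurable_times borel_measurable_const) auto
    show "(\<lambda>\<omega>. ennreal (exp (- (\<Sum>k=1..Suc n. (s k - s (k - 1)) * B (1 - t k) \<omega>)))) \<in> borel_measurable M"
      using B_meas
      by (intro measurable_compose[OF _ measurable_ennreal] borel_measurable_exp borel_measurable_uminus
          borel_measurable_sum borel_measurable_times borel_measurable_const) auto
    show "AE \<omega> in M. ennreal (f i \<omega>) \<le> 1" for i
    proof -
      have "AE \<omega> in M. \<forall>k\<in>{1..Suc n}. 0 \<le> B (v i * (1 - t k)) \<omega>"
        using range AE_excursion_nonneg by (intro AE_finite_allI) auto
      then show ?thesis
      proof eventually_elim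
        fix \<omega> assume "\<forall>k\<in>{1..Suc n}. 0 \<le> B (v i * (1 - t k)) \<omega>"
        then have "0 \<le> (\<Sum>k=1..Suc n. (s k - s (k - 1)) * (v i powr (- 1 / 2) * B (v i * (1 - t k)) \<omega>))"
          by (intro sum_nonneg mult_nonneg_nonneg s_pos) auto
        then show "ennreal (f i \<omega>) \<le> 1" unfolding f_def by simp
      qed
    qed
    show "AE \<omega> in M. (\<lambda>i. ennreal (f i \<omega>)) \<longlonglongrightarrow> ennreal (exp (- (\<Sum>k=1..Suc n. (s k - s (k - 1)) * B (1 - t k) \<omega>)))"
    proof (rule AE_I2)
      fix \<omega> assume \<omega>: "\<omega> \<in> space M"
      have "(\<lambda>i. v i powr (- 1 / 2) * B (v i * (1 - t k)) \<omega>) \<longlonglongrightarrow> 1 powr (- 1 / 2) * B (1 - t k) \<omega>"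
        if k: "k \<in> {1..Suc n}" for k
      proof (intro tendsto_mult tendsto_powr v_lim tendsto_const)
        have "(\<lambda>i. v i * (1 - t k)) \<longlonglongrightarrow> 1 * (1 - t k)"
          by (intro tendsto_mult v_lim tendsto_const)
        then show "(\<lambda>i. B (v i * (1 - t k)) \<omega>) \<longlonglongrightarrow> B (1 - t k) \<omega>"
          using range[OF k] t_range[OF k]
          by (intro continuous_on_tendsto_compose[OF continuous_paths[OF \<omega>]]) auto
      qed simp
      then show "(\<lambda>i. ennreal (f i \<omega>)) \<longlonglongrightarrow> ennreal (exp (- (\<Sum>k=1..Suc n. (s k - s (k - 1)) * B (1 - t k) \<omega>)))"
        unfolding f_def
        by (intro tendsto_ennrealI tendsto_exp tendsto_minus tendsto_sum tendsto_mult tendsto_const) simp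
    qed
  qed (simp_all add: emeasure_space_1)
  moreover have "(\<integral>\<^sup>+\<omega>. ennreal (f i \<omega>) \<partial>M) = ennreal (v i powr (- 3 / 2) / sqrt (2 * pi)) * (\<integral>\<^sup>+x. h i x \<partial>half_line)" for i
  proof -
    have "(\<integral>\<^sup>+\<omega>. ennreal (f i \<omega>) \<partial>M) = (\<integral>\<^sup>+x. ennreal (v i powr (- 3 / 2) / sqrt (2 * pi) * (sqrt x * exp (- (1 / v i - 1) * x / 2) * ?W x)) \<partial>half_line)"
      unfolding f_def by (rule rescaled_excursion_laplace_interior) (use assms v in auto)
    also have "\<dots> = (\<integral>\<^sup>+x. ennreal (v i powr (- 3 / 2) / sqrt (2 * pi)) * h i x \<partial>half_line)"
      unfolding h_def by (rule nn_integral_half_line_cong) (subst ennreal_mult'[symmetric], auto)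
    also have "\<dots> = ennreal (v i powr (- 3 / 2) / sqrt (2 * pi)) * (\<integral>\<^sup>+x. h i x \<partial>half_line)"
      by (rule nn_integral_cmult) (simp add: h_def del: feynman_kac.simps)
    finally show ?thesis .
  qed
  moreover have "(\<lambda>i. ennreal (v i powr (- 3 / 2) / sqrt (2 * pi)) * (\<integral>\<^sup>+x. h i x \<partial>half_line))
      \<longlonglongrightarrow> ennreal (1 powr (- 3 / 2) / sqrt (2 * pi)) * (\<integral>\<^sup>+x. ennreal (indicator {0<..} x * (sqrt x * exp (- (1 / 1 - 1) * x / 2) * ?W x)) \<partial>half_line)"
  proof (rule tendsto_mult_ennreal)
    show "(\<lambda>i. ennreal (v i powr (- 3 / 2) / sqrt (2 * pi))) \<longlonglongrightarrow> ennreal (1 powr (- 3 / 2) / sqrt (2 * pi))"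
      by (intro tendsto_ennrealI tendsto_divide tendsto_powr v_lim tendsto_const) auto
    show "(\<lambda>i. \<integral>\<^sup>+x. h i x \<partial>half_line)
      \<longlonglongrightarrow> (\<integral>\<^sup>+x. ennreal (indicator {0<..} x * (sqrt x * exp (- (1 / 1 - 1) * x / 2) * ?W x)) \<partial>half_line)"
    proof (rule nn_integral_LIMSEQ)
      show "incseq h"
      proof (intro incseq_SucI le_funI)
        fix i x
        show "h i x \<le> h (Suc i) x"
        proof (cases "0 < x")
          case True
          have "1 / v (Suc i) \<le> 1 / v i"
            using v[of i] v_mono[of i "Suc i"] by (intro divide_left_mono) auto
          then have "(1 / v (Suc i) - 1) * x \<le> (1 / v i - 1) * x"
            using True by (intro mult_right_mono) auto
          from divide_right_mono[OF le_imp_neg_le[OF this], of 2]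
          have "exp (- (1 / v i - 1) * x / 2) \<le> exp (- (1 / v (Suc i) - 1) * x / 2)"
            by (simp only: exp_le_cancel_iff mult_minus_left zero_le_numeral)
          then show ?thesis
            unfolding h_def using True W[OF True]
            by (intro ennreal_leI mult_left_mono mult_right_mono) auto
        qed (simp add: h_def)
      qed
      show "(\<lambda>i. h i x) \<longlonglongrightarrow> ennreal (indicator {0<..} x * (sqrt x * exp (- (1 / 1 - 1) * x / 2) * ?W x))" for x
        unfolding h_def by (intro tendsto_ennrealI tendsto_intros v_lim) auto
    qed (simp add: h_def del: feynman_kac.simps)
  qed simp
  ultimately have "(\<integral>\<^sup>+\<omega>. ennreal (exp (- (\<Sum>k=1..Suc n. (s k - s (k - 1)) * B (1 - t k) \<omega>))) \<partial>M)
      = ennreal (1 powr (- 3 / 2) / sqrt (2 * pi)) * (\<integral>\<^sup>+x. ennreal (indicator {0<..} x * (sqrt x * exp (- (1 / 1 - 1) * x / 2) * ?W x)) \<partial>half_line)"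
    by (simp only:) (rule LIMSEQ_unique)
  also have "\<dots> = (\<integral>\<^sup>+x. ennreal (1 powr (- 3 / 2) / sqrt (2 * pi)) * ennreal (indicator {0<..} x * (sqrt x * exp (- (1 / 1 - 1) * x / 2) * ?W x)) \<partial>half_line)"
    by (rule nn_integral_cmult[symmetric]) (simp del: feynman_kac.simps)
  also have "\<dots> = (\<integral>\<^sup>+x. ennreal (1 / sqrt (2 * pi) * (sqrt x * ?W x)) \<partial>half_line)"
    by (rule nn_integral_half_line_cong) (subst ennreal_mult'[symmetric], auto)
  finally show ?thesis .
qed

text \<open>Without time points the identity says that the spectral weight has total mass one after
  multiplication by \<open>exp(-x / 2)\<close>. It serves as the case that remains when the only time point of the
  meander is zero.\<close>

lemma rescaled_excursion_laplace_no_times: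
  assumes "t 0 = 0" "t 1 = 1" "0 < v"
  shows "(\<integral>\<^sup>+x. ennreal (v powr (- 3 / 2) / sqrt (2 * pi) * (sqrt x * exp (- (1 / v - 1) * x / 2) *
        feynman_kac (rev_increment 0 t) c 0 x)) \<partial>half_line) = 1"
proof -
  let ?C = "v powr (- 3 / 2) / sqrt (2 * pi)" and ?a = "1 / (2 * v)"
  have "(\<integral>\<^sup>+x. ennreal (?C * (sqrt x * exp (- (1 / v - 1) * x / 2) * feynman_kac (rev_increment 0 t) c 0 x)) \<partial>half_line)
      = (\<integral>\<^sup>+x. ennreal ?C * ennreal (sqrt x * exp (- ?a * x)) \<partial>half_line)"
  proof (rule nn_integral_half_line_cong)
    fix x :: real
    have "exp (- (1 / v - 1) * x / 2) * exp (- x / 2) = exp (- ?a * x)"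
      unfolding exp_add[symmetric] using assms by (intro arg_cong[where f = exp]) (simp add: field_simps)
    then show "ennreal (?C * (sqrt x * exp (- (1 / v - 1) * x / 2) * feynman_kac (rev_increment 0 t) c 0 x))
        = ennreal ?C * ennreal (sqrt x * exp (- ?a * x))"
      using assms by (subst ennreal_mult'[symmetric]) (simp_all add: rev_increment_def mult.assoc)
  qed
  also have "\<dots> = ennreal ?C * ennreal (sqrt pi / (2 * ?a * sqrt ?a))"
    using assms by (subst nn_integral_cmult, simp, subst half_line_gamma_three_halves) auto
  also have "\<dots> = ennreal (?C * (sqrt pi / (2 * ?a * sqrt ?a)))"
    by (rule ennreal_mult'[symmetric]) simp
  also have "?C * (sqrt pi / (2 * ?a * sqrt ?a)) = 1"
  proof -
    have "v powr (3 / 2) = v powr (1 + 1 / 2)" by simp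
    also have "\<dots> = v * sqrt v" using assms unfolding powr_add by (simp add: powr_half_sqrt)
    finally have "v powr (- 3 / 2) = 1 / (v * sqrt v)"
      by (simp add: powr_minus inverse_eq_divide)
    moreover have "sqrt ?a = 1 / (sqrt 2 * sqrt v)"
      by (simp add: real_sqrt_divide real_sqrt_mult)
    ultimately show ?thesis
      using assms by (simp add: real_sqrt_mult)
  qed
  finally show ?thesis by simp
qed

section \<open>Averaging over the length\<close>

text \<open>A process with continuous paths is jointly measurable in time and path: the time is rounded down
  to a multiple of \<open>1 / (i + 1)\<close>, which leaves finitely many coordinates, and \<open>i\<close> tends to infinity.
  Joint measurability is needed with respect to the sigma-algebra generated by the path, for this is the one
  that is independent of the length \<open>V\<close>.\<close>

lemma measurable_continuous_path:
  fixes B :: "real \<Rightarrow> 'a \<Rightarrow> real" and g :: "'c \<Rightarrow> real"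
  assumes B: "\<And>r. r \<in> {0..1} \<Longrightarrow> B r \<in> borel_measurable N"
    and paths: "\<And>\<omega>. \<omega> \<in> space N \<Longrightarrow> continuous_on {0..1} (\<lambda>r. B r \<omega>)"
    and [measurable]: "g \<in> borel_measurable S" and g: "\<And>v. v \<in> space S \<Longrightarrow> g v \<in> {0..1}"
  shows "(\<lambda>(v, \<omega>). B (g v) \<omega>) \<in> borel_measurable (S \<Otimes>\<^sub>M N)"
proof (rule borel_measurable_LIMSEQ_real)
  let ?r = "\<lambda>i v. real_of_int \<lfloor>real (Suc i) * g v\<rfloor> / real (Suc i)"
  let ?u = "\<lambda>i (v, \<omega>). \<Sum>j\<le>Suc i. if \<lfloor>real (Suc i) * g v\<rfloor> = int j then B (real j / real (Suc i)) \<omega> else 0"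
  show "?u i \<in> borel_measurable (S \<Otimes>\<^sub>M N)" for i
  proof -
    have "(\<lambda>p. if \<lfloor>real (Suc i) * g (fst p)\<rfloor> = int j then B (real j / real (Suc i)) (snd p) else 0)
        \<in> borel_measurable (S \<Otimes>\<^sub>M N)" if "j \<in> {..Suc i}" for j
    proof -
      have [measurable]: "B (real j / real (Suc i)) \<in> borel_measurable N"
        using that by (intro B) (auto simp: divide_le_eq_1)
      show ?thesis by measurable
    qed
    then show ?thesis unfolding case_prod_beta by (rule borel_measurable_sum)
  qed
  fix p assume "p \<in> space (S \<Otimes>\<^sub>M N)"
  then obtain v \<omega> where p: "p = (v, \<omega>)" "v \<in> space S" "\<omega> \<in> space N"
    by (auto simp: space_pair_measure)
  have bounds: "0 \<le> \<lfloor>real (Suc i) * g v\<rfloor>" "\<lfloor>real (Suc i) * g v\<rfloor> \<le> int (Suc i)" for i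
  proof -
    have "real (Suc i) * g v \<le> real (Suc i) * 1"
      using g[OF p(2)] by (intro mult_left_mono) auto
    from floor_mono[OF this] show "\<lfloor>real (Suc i) * g v\<rfloor> \<le> int (Suc i)"
      by (simp only: mult_1_right floor_of_nat)
  qed (use g[OF p(2)] in auto)
  have r: "?r i v \<in> {0..1}" for i
    using bounds[of i] by (auto simp: divide_le_eq_1)
  have u_eq: "?u i p = B (?r i v) \<omega>" for i
  proof -
    obtain m where m: "\<lfloor>real (Suc i) * g v\<rfloor> = int m" "m \<le> Suc i"
      using bounds[of i] by (metis nonneg_int_cases of_nat_le_iff)
    have "?u i p = (\<Sum>j\<le>Suc i. if j = m then B (real m / real (Suc i)) \<omega> else 0)"
      unfolding p m prod.case by (rule sum.cong) auto
    also have "\<dots> = B (?r i v) \<omega>"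
      unfolding m using m(2) by (simp del: sum.atMost_Suc)
    finally show ?thesis .
  qed
  have "(\<lambda>i. ?r i v) \<longlonglongrightarrow> g v"
  proof (rule tendsto_sandwich)
    show "\<forall>\<^sub>F i in sequentially. g v - 1 / real (Suc i) \<le> ?r i v"
    proof (rule always_eventually, rule allI)
      fix i
      have "real (Suc i) * g v - 1 \<le> real_of_int \<lfloor>real (Suc i) * g v\<rfloor>" by linarith
      then have "(real (Suc i) * g v - 1) / real (Suc i) \<le> ?r i v" by (rule divide_right_mono) simp
      then show "g v - 1 / real (Suc i) \<le> ?r i v" by (simp add: diff_divide_distrib)
    qed
    show "\<forall>\<^sub>F i in sequentially. ?r i v \<le> g v"
    proof (rule always_eventually, rule allI)
      fix i
      have "?r i v \<le> (real (Suc i) * g v) / real (Suc i)" by (rule divide_right_mono) linarith+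
      then show "?r i v \<le> g v" by simp
    qed
    have "(\<lambda>i. g v - 1 / real (Suc i)) \<longlonglongrightarrow> g v - 0"
      by (intro tendsto_diff tendsto_const LIMSEQ_Suc lim_1_over_n)
    then show "(\<lambda>i. g v - 1 / real (Suc i)) \<longlonglongrightarrow> g v" by simp
  qed simp
  then have "(\<lambda>i. B (?r i v) \<omega>) \<longlonglongrightarrow> B (g v) \<omega>"
    using r g[OF p(2)]
    by (intro continuous_on_tendsto_compose[OF paths[OF p(3)]]) auto
  then show "(\<lambda>i. ?u i p) \<longlonglongrightarrow> (case p of (v, \<omega>) \<Rightarrow> B (g v) \<omega>)"
    by (simp only: u_eq) (simp add: p(1))
qed

text \<open>The joint law of \<open>V\<close> and the sample point, the latter observed through the sub-sigma-algebra
  \<open>N\<close>, is a product measure, since it has the right values on rectangles.\<close>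

lemma (in prob_space) nn_integral_independent_pair:
  assumes V: "random_variable \<nu> V" "distr M \<nu> V = \<nu>"
    and N: "(\<lambda>\<omega>. \<omega>) \<in> measurable M N" "space N = space M"
    and indep: "indep_set (sets (vimage_algebra (space M) V \<nu>)) (sets N)"
    and \<Phi>: "\<Phi> \<in> borel_measurable (\<nu> \<Otimes>\<^sub>M N)"
  shows "(\<integral>\<^sup>+\<omega>. \<Phi> (V \<omega>, \<omega>) \<partial>M) = (\<integral>\<^sup>+v. (\<integral>\<^sup>+\<omega>. \<Phi> (v, \<omega>) \<partial>M) \<partial>\<nu>)"
proof -
  note [measurable] = V(1) N(1)
  interpret \<nu>: prob_space \<nu>
    using prob_space_distr[OF V(1)] V(2) by simp
  interpret D: prob_space "distr M N (\<lambda>\<omega>. \<omega>)" by (rule prob_space_distr) fact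
  have eq: "\<nu> \<Otimes>\<^sub>M distr M N (\<lambda>\<omega>. \<omega>) = distr M (\<nu> \<Otimes>\<^sub>M N) (\<lambda>\<omega>. (V \<omega>, \<omega>))"
  proof (rule pair_measure_eqI)
    show "sigma_finite_measure \<nu>" "sigma_finite_measure (distr M N (\<lambda>\<omega>. \<omega>))"
      by unfold_locales
    show "sets (\<nu> \<Otimes>\<^sub>M distr M N (\<lambda>\<omega>. \<omega>)) = sets (distr M (\<nu> \<Otimes>\<^sub>M N) (\<lambda>\<omega>. (V \<omega>, \<omega>)))"
      by (simp cong: sets_pair_measure_cong)
    fix A C assume A: "A \<in> sets \<nu>" and "C \<in> sets (distr M N (\<lambda>\<omega>. \<omega>))"
    then have C: "C \<in> sets N" by simp
    have C_sub: "C \<subseteq> space M" using sets.sets_into_space[OF C] N(2) by simp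
    have C_M: "C \<in> events" using measurable_sets[OF N(1) C] C_sub by (simp add: Int_absorb2)
    have A_M: "V -` A \<inter> space M \<in> events" using V(1) A by (rule measurable_sets)
    have "V -` A \<inter> space M \<in> sets (vimage_algebra (space M) V \<nu>)"
      by (rule in_vimage_algebra[OF A])
    then have "prob ((V -` A \<inter> space M) \<inter> C) = prob (V -` A \<inter> space M) * prob C"
      by (rule indep_setD[OF indep]) (rule C)
    moreover have "emeasure \<nu> A = emeasure M (V -` A \<inter> space M)"
      using emeasure_distr[OF V(1) A] V(2) by simp
    moreover have "emeasure (distr M N (\<lambda>\<omega>. \<omega>)) C = emeasure M C"
      using C_sub by (simp add: emeasure_distr[OF N(1) C] Int_absorb2)
    moreover have "emeasure (distr M (\<nu> \<Otimes>\<^sub>M N) (\<lambda>\<omega>. (V \<omega>, \<omega>))) (A \<times> C) = emeasure M ((V -` A \<inter> space M) \<inter> C)"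
      using A C C_sub by (subst emeasure_distr) (auto intro!: arg_cong[where f = "emeasure M"])
    ultimately show "emeasure \<nu> A * emeasure (distr M N (\<lambda>\<omega>. \<omega>)) C
        = emeasure (distr M (\<nu> \<Otimes>\<^sub>M N) (\<lambda>\<omega>. (V \<omega>, \<omega>))) (A \<times> C)"
      by (simp add: emeasure_eq_measure ennreal_mult)
  qed
  have "(\<integral>\<^sup>+\<omega>. \<Phi> (V \<omega>, \<omega>) \<partial>M) = (\<integral>\<^sup>+z. \<Phi> z \<partial>distr M (\<nu> \<Otimes>\<^sub>M N) (\<lambda>\<omega>. (V \<omega>, \<omega>)))"
    using V(1) N(1) \<Phi> by (subst nn_integral_distr) auto
  also have "\<dots> = (\<integral>\<^sup>+v. (\<integral>\<^sup>+\<omega>. \<Phi> (v, \<omega>) \<partial>distr M N (\<lambda>\<omega>. \<omega>)) \<partial>\<nu>)"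
    unfolding eq[symmetric] by (rule D.nn_integral_fst[symmetric]) (use \<Phi> in \<open>simp cong: measurable_cong_sets\<close>)
  also have "\<dots> = (\<integral>\<^sup>+v. (\<integral>\<^sup>+\<omega>. \<Phi> (v, \<omega>) \<partial>M) \<partial>\<nu>)"
  proof (rule nn_integral_cong)
    fix v assume "v \<in> space \<nu>"
    then show "(\<integral>\<^sup>+\<omega>. \<Phi> (v, \<omega>) \<partial>distr M N (\<lambda>\<omega>. \<omega>)) = (\<integral>\<^sup>+\<omega>. \<Phi> (v, \<omega>) \<partial>M)"
      using N(1) \<Phi> by (subst nn_integral_distr) auto
  qed
  finally show ?thesis .
qed

text \<open>The density in \<open>x\<close> whose average over the law \<open>\<nu>\<close> of \<open>v\<close> is \<open>meander_phi \<nu>\<close>.\<close>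

definition spectral_weight :: "real \<Rightarrow> real \<Rightarrow> real" where
  "spectral_weight v x = v powr (- 3 / 2) / sqrt (2 * pi) * (sqrt x * exp (- (1 / v - 1) * x / 2))"

text \<open>For fixed \<open>x > 0\<close> the integrand \<open>exp(-x / (2 v)) v\<^bsup>-3/2\<^esup>\<close> is bounded in \<open>v\<close>, hence integrable for
  the probability measure \<open>\<nu>\<close>.\<close>

lemma nn_integral_spectral_weight:
  fixes \<nu> :: "real measure"
  assumes "prob_space \<nu>" and sets: "sets \<nu> = sets (restrict_space borel {0..1})"
    and "AE v in \<nu>. v \<noteq> 0" and "0 < x"
  shows "(\<integral>\<^sup>+v. ennreal (spectral_weight v x) \<partial>\<nu>) = ennreal (meander_phi \<nu> x)"
    and "0 \<le> meander_phi \<nu> x"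
proof -
  interpret prob_space \<nu> by fact
  have space: "space \<nu> = {0..1}"
    using sets_eq_imp_space_eq[OF sets] by (simp add: space_restrict_space)
  have [measurable]: "(\<lambda>v. v) \<in> borel_measurable \<nu>"
    using measurable_restrict_space1[of "\<lambda>v::real. v" borel borel "{0..1}"] sets
    by (simp cong: measurable_cong_sets)
  let ?g = "\<lambda>v. exp (- x / (2 * v)) * v powr (- 3 / 2)"
  let ?h = "\<lambda>v. indicator {0<..1} v * ?g v"
  have bound: "?g v \<le> (3 / x) powr (3 / 2)" if "0 < v" for v
  proof -
    (* Chosen such that exp y, raised to the power 3/2, is exp (x / (2 * v)). *)
    define y where "y = x / (3 * v)"
    have "0 < y" using that \<open>0 < x\<close> by (simp add: y_def)
    have "y \<le> exp y" using exp_ge_add_one_self[of y] by linarith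
    then have "y powr (3 / 2) \<le> exp y powr (3 / 2)"
      using \<open>0 < y\<close> by (intro powr_mono2) auto
    also have "\<dots> = exp (x / (2 * v))"
      using that by (simp add: powr_def y_def)
    finally have le: "y powr (3 / 2) \<le> exp (x / (2 * v))" .
    have "?g v = v powr (- 3 / 2) / exp (x / (2 * v))"
      by (simp add: exp_minus inverse_eq_divide)
    also have "\<dots> \<le> v powr (- 3 / 2) / y powr (3 / 2)"
      using le \<open>0 < y\<close> by (intro divide_left_mono) auto
    also have "\<dots> = (1 / v) powr (3 / 2) / y powr (3 / 2)"
      using that by (simp add: powr_minus powr_divide inverse_eq_divide powr_mult)
    also have "\<dots> = ((1 / v) / y) powr (3 / 2)"
      using that \<open>0 < y\<close> by (simp add: powr_divide powr_mult)
    also have "(1 / v) / y = 3 / x"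
      using that by (simp add: y_def)
    finally show ?thesis .
  qed
  have int: "integrable \<nu> ?h"
    by (rule integrable_const_bound[where B = "(3 / x) powr (3 / 2)"])
       (use bound in \<open>auto simp: indicator_def\<close>)
  have phi: "meander_phi \<nu> x = sqrt x * exp (x / 2) / sqrt (2 * pi) * (\<integral>v. ?h v \<partial>\<nu>)"
    by (simp add: meander_phi_def set_lebesgue_integral_def)
  show "0 \<le> meander_phi \<nu> x"
    unfolding phi using \<open>0 < x\<close> by (intro mult_nonneg_nonneg integral_nonneg) auto
  have "(\<integral>\<^sup>+v. ennreal (spectral_weight v x) \<partial>\<nu>) = (\<integral>\<^sup>+v. ennreal (sqrt x * exp (x / 2) / sqrt (2 * pi) * ?h v) \<partial>\<nu>)"
  proof (rule nn_integral_cong_AE)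
    show "AE v in \<nu>. ennreal (spectral_weight v x) = ennreal (sqrt x * exp (x / 2) / sqrt (2 * pi) * ?h v)"
      using assms(3) AE_space
    proof eventually_elim
      fix v assume "v \<noteq> 0" "v \<in> space \<nu>"
      then have v: "0 < v" "v \<le> 1" by (auto simp: space)
      have "exp (- (1 / v - 1) * x / 2) = exp (x / 2) * exp (- x / (2 * v))"
        unfolding exp_add[symmetric] using v by (intro arg_cong[where f = exp]) (simp add: field_simps)
      then show "ennreal (spectral_weight v x) = ennreal (sqrt x * exp (x / 2) / sqrt (2 * pi) * ?h v)"
        using v by (simp add: spectral_weight_def ac_simps)
    qed
  qed
  also have "\<dots> = ennreal (\<integral>v. sqrt x * exp (x / 2) / sqrt (2 * pi) * ?h v \<partial>\<nu>)"
    using int \<open>0 < x\<close> by (intro nn_integral_eq_integral integrable_mult_right) auto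
  also have "(\<integral>v. sqrt x * exp (x / 2) / sqrt (2 * pi) * ?h v \<partial>\<nu>) = meander_phi \<nu> x"
    unfolding phi by (rule integral_mult_right_zero)
  finally show "(\<integral>\<^sup>+v. ennreal (spectral_weight v x) \<partial>\<nu>) = ennreal (meander_phi \<nu> x)" .
qed

lemma rescaled_excursion_laplace:
  fixes s t :: "nat \<Rightarrow> real"
  assumes "brownian_excursion M B"
    and s: "\<And>k. k < d \<Longrightarrow> s k < s (Suc k)"
    and t: "t 0 = 0" "t 0 \<le> t 1" "\<And>k. k \<in> {1..d} \<Longrightarrow> t k < t (Suc k)" "t (Suc d) = 1"
    and v: "0 < v" "v \<le> 1"
  shows "(\<integral>\<^sup>+\<omega>. ennreal (exp (- (\<Sum>k=1..d. (s k - s (k - 1)) * (v powr (- 1 / 2) * B (v * (1 - t k)) \<omega>)))) \<partial>M)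
    = (\<integral>\<^sup>+x. ennreal (spectral_weight v x * feynman_kac (rev_increment d t) (rev_increment d s) d x) \<partial>half_line)"
proof -
  interpret brownian_excursion M B by fact
  consider "d = 0" | n where "d = Suc n" "v = 1" "t 1 = 0" | n where "d = Suc n" "v * (1 - t 1) < 1"
  proof (cases d)
    case (Suc n)
    have "v * (1 - t 1) < 1" if "v \<noteq> 1 \<or> t 1 \<noteq> 0"
    proof (cases "t 1 = 0")
      case False
      then have "v * (1 - t 1) < v * 1" using t v by (intro mult_strict_left_mono) auto
      also have "\<dots> \<le> 1" using v by simp
      finally show ?thesis .
    qed (use that v in auto)
    then show ?thesis using that Suc by blast
  qed (use that in auto)
  then show ?thesis
  proof cases
    case 1
    then show ?thesis
      using rescaled_excursion_laplace_no_times[of t v "rev_increment 0 s"] t v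
      by (simp add: spectral_weight_def emeasure_space_1 mult.assoc)
  next
    case 2
    then show ?thesis
      using rescaled_excursion_laplace_endpoint[OF assms(1), of n s t] s t
      by (simp add: spectral_weight_def mult.assoc del: feynman_kac.simps)
  next
    case 3
    then show ?thesis
      using rescaled_excursion_laplace_interior[OF assms(1), of n s t v] s t v
      by (simp add: spectral_weight_def mult.assoc del: feynman_kac.simps)
  qed
qed

text \<open>The duality when all times \<open>1 - t k\<close> of the meander are positive. The case \<open>d = 0\<close> is included,
  since the theorem reduces to it when \<open>d = 1\<close> and \<open>t 1 = 1\<close>.\<close>

lemma meander_duality_positive_times:
  fixes \<nu> :: "real measure"
    and M :: "'a measure" and B :: "real \<Rightarrow> 'a \<Rightarrow> real" and V :: "'a \<Rightarrow> real"
    and P :: "real \<Rightarrow> 'b measure" and X :: "real \<Rightarrow> 'b \<Rightarrow> real"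
    and d :: nat and s t :: "nat \<Rightarrow> real"
  assumes \<nu>: "prob_space \<nu>" and sets: "sets \<nu> = sets (restrict_space borel {0..1})"
    and "measure \<nu> {0} = 0"
    and B: "brownian_excursion M B"
    and V: "V \<in> M \<rightarrow>\<^sub>M \<nu>" "distr M \<nu> V = \<nu>"
    and indep: "prob_space.indep_set M (sets (vimage_algebra (space M) V \<nu>))
           (sets (vimage_algebra (space M) (\<lambda>\<omega>. \<lambda>r\<in>{0..1}. B r \<omega>) (\<Pi>\<^sub>M r\<in>{0..1}. borel)))"
    and X: "\<And>x. x > 0 \<Longrightarrow> markov_process_from trans_density (P x) X x"
    and s: "s 0 = 0" "\<And>k. k < d \<Longrightarrow> s k < s (Suc k)"
    and t: "t 0 = 0" "t 0 \<le> t 1" "\<And>k. k \<in> {1..d} \<Longrightarrow> t k < t (Suc k)" "t (Suc d) = 1"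
  shows "(LINT \<omega>|M. exp (- (\<Sum>k=1..d. (s k - s (k - 1)) * generalized_meander V B (1 - t k) \<omega>)))
       = (LINT x:{0<..}|lborel.
            (LINT \<omega>|P x. exp (- (1 / 2) * (\<Sum>k=0..d. (t (Suc k) - t k) * X (s k) \<omega>)))
              * meander_phi \<nu> x)"
proof -
  interpret brownian_excursion M B by fact
  interpret \<nu>: prob_space \<nu> by fact
  let ?N = "vimage_algebra (space M) (\<lambda>\<omega>. \<lambda>r\<in>{0..1}. B r \<omega>) (\<Pi>\<^sub>M r\<in>{0..1::real}. borel :: real measure)"
  let ?W = "feynman_kac (rev_increment d t) (rev_increment d s) d"
  let ?\<Phi> = "\<lambda>(v, \<omega>). exp (- (\<Sum>k=1..d. (s k - s (k - 1)) * (v powr (- 1 / 2) * B (v * (1 - t k)) \<omega>)))"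
  have space_\<nu>: "space \<nu> = {0..1}"
    using sets_eq_imp_space_eq[OF sets] by (simp add: space_restrict_space)
  have [measurable]: "(\<lambda>v. v) \<in> borel_measurable \<nu>"
    using measurable_restrict_space1[of "\<lambda>v::real. v" borel borel "{0..1}"] sets
    by (simp cong: measurable_cong_sets)
  have "{0} \<in> sets \<nu>"
    unfolding sets by (auto simp: sets_restrict_space)
  then have AE_\<nu>: "AE v in \<nu>. v \<noteq> 0"
    using \<open>measure \<nu> {0} = 0\<close>
    by (intro AE_I[where N = "{0}"]) (auto simp: \<nu>.emeasure_eq_measure space_\<nu>)
  have t_range: "0 \<le> t k \<and> t k \<le> 1" if "k \<in> {1..d}" for k
  proof -
    have "t 1 \<le> t k" "t k \<le> t (Suc d)"
      by (rule increasing_on_interval_le[of 1 "Suc d"]; use that t(3) in \<open>auto intro: less_imp_le\<close>)+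
    then show ?thesis using t by simp
  qed
  have path: "(\<lambda>\<omega>. \<lambda>r\<in>{0..1}. B r \<omega>) \<in> measurable M (\<Pi>\<^sub>M r\<in>{0..1::real}. borel)"
    by (rule measurable_restrict) (rule random_variable_B)
  have N_id: "(\<lambda>\<omega>. \<omega>) \<in> measurable M ?N"
    by (rule measurable_vimage_algebra2) (use path in auto)
  have N_B: "B r \<in> borel_measurable ?N" if "r \<in> {0..1}" for r
  proof -
    have "(\<lambda>\<omega>. (\<lambda>r\<in>{0..1}. B r \<omega>) r) \<in> borel_measurable ?N"
      by (rule measurable_compose[OF measurable_vimage_algebra1 measurable_component_singleton[OF that]])
         (rule Pi_I, rule measurable_space[OF path])
    then show ?thesis using that by simp
  qed
  have \<Phi>: "?\<Phi> \<in> borel_measurable (\<nu> \<Otimes>\<^sub>M ?N)"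
  proof -
    have [measurable]: "(\<lambda>p. B (fst p * (1 - t k)) (snd p)) \<in> borel_measurable (\<nu> \<Otimes>\<^sub>M ?N)"
      if "k \<in> {1..d}" for k
    proof -
      have "(\<lambda>(v, \<omega>). B (v * (1 - t k)) \<omega>) \<in> borel_measurable (\<nu> \<Otimes>\<^sub>M ?N)"
        by (rule measurable_continuous_path)
           (use N_B continuous_paths t_range[OF that] in \<open>auto simp: space_\<nu> intro!: mult_le_one\<close>)
      then show ?thesis by (simp add: case_prod_beta)
    qed
    show ?thesis unfolding case_prod_beta by measurable
  qed
  have rv: "(\<lambda>\<omega>. ?\<Phi> (V \<omega>, \<omega>)) \<in> borel_measurable M"
    using measurable_compose[OF measurable_Pair[OF V(1) N_id] \<Phi>] .
  have c_pos: "0 < rev_increment d s k" if "k \<in> {1..d}" for k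
    using that by (intro rev_increment_pos s) auto
  have W_nonneg: "0 \<le> ?W x" if "0 < x" for x
    using that c_pos by (intro feynman_kac_nonneg) auto
  note phi = nn_integral_spectral_weight[OF \<nu> sets AE_\<nu>]
  have [measurable]: "(\<lambda>(v, x). spectral_weight v x) \<in> borel_measurable (\<nu> \<Otimes>\<^sub>M borel)"
    unfolding spectral_weight_def by measurable
  interpret pair_sigma_finite \<nu> half_line ..
  have "(\<integral>\<^sup>+\<omega>. ennreal (?\<Phi> (V \<omega>, \<omega>)) \<partial>M) = (\<integral>\<^sup>+v. (\<integral>\<^sup>+\<omega>. ennreal (?\<Phi> (v, \<omega>)) \<partial>M) \<partial>\<nu>)"
    by (rule nn_integral_independent_pair[OF V N_id _ indep]) (use \<Phi> in auto)
  also have "\<dots> = (\<integral>\<^sup>+v. (\<integral>\<^sup>+x. ennreal (spectral_weight v x * ?W x) \<partial>half_line) \<partial>\<nu>)"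
  proof (rule nn_integral_cong_AE)
    show "AE v in \<nu>. (\<integral>\<^sup>+\<omega>. ennreal (?\<Phi> (v, \<omega>)) \<partial>M) = (\<integral>\<^sup>+x. ennreal (spectral_weight v x * ?W x) \<partial>half_line)"
      using AE_\<nu> AE_space
    proof eventually_elim
      fix v assume "v \<noteq> 0" "v \<in> space \<nu>"
      then have v: "0 < v" "v \<le> 1" by (auto simp: space_\<nu>)
      show "(\<integral>\<^sup>+\<omega>. ennreal (?\<Phi> (v, \<omega>)) \<partial>M) = (\<integral>\<^sup>+x. ennreal (spectral_weight v x * ?W x) \<partial>half_line)"
        unfolding prod.case by (rule rescaled_excursion_laplace[OF B]) (use s(2) t v in auto)
    qed
  qed
  also have "\<dots> = (\<integral>\<^sup>+x. (\<integral>\<^sup>+v. ennreal (spectral_weight v x * ?W x) \<partial>\<nu>) \<partial>half_line)"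
    by (rule Fubini'[symmetric]) measurable
  also have "\<dots> = (\<integral>\<^sup>+x. ennreal (?W x * meander_phi \<nu> x) \<partial>half_line)"
  proof (rule nn_integral_half_line_cong)
    fix x :: real assume "0 < x"
    have "(\<integral>\<^sup>+v. ennreal (spectral_weight v x * ?W x) \<partial>\<nu>) = (\<integral>\<^sup>+v. ennreal (?W x) * ennreal (spectral_weight v x) \<partial>\<nu>)"
      using W_nonneg[OF \<open>0 < x\<close>] by (intro nn_integral_cong) (simp add: ennreal_mult'' mult.commute)
    also have "\<dots> = ennreal (?W x) * (\<integral>\<^sup>+v. ennreal (spectral_weight v x) \<partial>\<nu>)"
      by (rule nn_integral_cmult) measurable
    finally show "(\<integral>\<^sup>+v. ennreal (spectral_weight v x * ?W x) \<partial>\<nu>) = ennreal (?W x * meander_phi \<nu> x)"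
      using W_nonneg[OF \<open>0 < x\<close>] by (simp add: phi \<open>0 < x\<close> ennreal_mult')
  qed
  finally have nn_eq: "(\<integral>\<^sup>+\<omega>. ennreal (?\<Phi> (V \<omega>, \<omega>)) \<partial>M) = (\<integral>\<^sup>+x. ennreal (?W x * meander_phi \<nu> x) \<partial>half_line)" .
  have [measurable]: "meander_phi \<nu> \<in> borel_measurable borel"
    unfolding meander_phi_def set_lebesgue_integral_def by measurable
  have "(LINT \<omega>|M. exp (- (\<Sum>k=1..d. (s k - s (k - 1)) * generalized_meander V B (1 - t k) \<omega>)))
      = (\<integral>\<omega>. ?\<Phi> (V \<omega>, \<omega>) \<partial>M)"
    by (simp add: generalized_meander_def)
  also have "\<dots> = enn2real (\<integral>\<^sup>+\<omega>. ennreal (?\<Phi> (V \<omega>, \<omega>)) \<partial>M)"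
    by (rule integral_eq_nn_integral[OF rv]) simp
  also have "\<dots> = (\<integral>x. ?W x * meander_phi \<nu> x \<partial>half_line)"
    unfolding nn_eq
    by (rule integral_eq_nn_integral[symmetric])
       (auto intro!: AE_half_lineI mult_nonneg_nonneg W_nonneg phi(2))
  also have "\<dots> = (LINT x:{0<..}|lborel. ?W x * meander_phi \<nu> x)"
    by (rule set_lebesgue_integral_half_line[symmetric]) measurable
  also have "\<dots> = (LINT x:{0<..}|lborel.
            (LINT \<omega>|P x. exp (- (1 / 2) * (\<Sum>k=0..d. (t (Suc k) - t k) * X (s k) \<omega>)))
              * meander_phi \<nu> x)"
  proof (rule set_lebesgue_integral_cong)
    show "\<forall>x. x \<in> {0<..} \<longrightarrow> ?W x * meander_phi \<nu> x =
        (LINT \<omega>|P x. exp (- (1 / 2) * (\<Sum>k=0..d. (t (Suc k) - t k) * X (s k) \<omega>))) * meander_phi \<nu> x"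
    proof (intro allI impI)
      fix x :: real assume "x \<in> {0<..}"
      then have "0 < x" by simp
      interpret X: markov_process_from trans_density "P x" X x by (rule X) fact
      have s_nonneg: "0 \<le> s k" if "k \<le> d" for k
        using increasing_on_interval_le[of 0 d s 0 k] that s by (auto intro: less_imp_le)
      have fk: "(\<integral>\<^sup>+\<omega>. ennreal (exp (- (1 / 2) * (\<Sum>k=0..d. (t (Suc k) - t k) * X (s k) \<omega>))) \<partial>P x) = ennreal (?W x)"
        by (rule feynman_kac_formula[OF X[OF \<open>0 < x\<close>]])
           (use s t in \<open>auto simp: rev_increment_def Suc_diff_le\<close>)
      have "(LINT \<omega>|P x. exp (- (1 / 2) * (\<Sum>k=0..d. (t (Suc k) - t k) * X (s k) \<omega>))) = enn2real (ennreal (?W x))"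
        unfolding fk[symmetric]
      proof (rule integral_eq_nn_integral)
        show "(\<lambda>\<omega>. exp (- (1 / 2) * (\<Sum>k=0..d. (t (Suc k) - t k) * X (s k) \<omega>))) \<in> borel_measurable (P x)"
        proof -
          have [measurable]: "X (s k) \<in> borel_measurable (P x)" if "k \<in> {0..d}" for k
            using that by (intro X.random_variable_X s_nonneg) simp
          show ?thesis by measurable
        qed
      qed simp
      then show "?W x * meander_phi \<nu> x =
        (LINT \<omega>|P x. exp (- (1 / 2) * (\<Sum>k=0..d. (t (Suc k) - t k) * X (s k) \<omega>))) * meander_phi \<nu> x"
        using W_nonneg[OF \<open>0 < x\<close>] by simp
    qed
  qed simp
  finally show ?thesis .
qed

theorem theorem3p1:
  fixes \<nu> :: "real measure"
    and M :: "'a measure" and B :: "real \<Rightarrow> 'a \<Rightarrow> real" and V :: "'a \<Rightarrow> real"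
    and P :: "real \<Rightarrow> 'b measure" and X :: "real \<Rightarrow> 'b \<Rightarrow> real"
    and d :: nat and s t :: "nat \<Rightarrow> real"
  assumes "prob_space \<nu>" and "sets \<nu> = sets (restrict_space borel {0..1})"
    and "measure \<nu> {0} = 0"
    and "brownian_excursion M B"
    and "V \<in> M \<rightarrow>\<^sub>M \<nu>" and "distr M \<nu> V = \<nu>"
    and "prob_space.indep_set M (sets (vimage_algebra (space M) V \<nu>))
           (sets (vimage_algebra (space M) (\<lambda>\<omega>. \<lambda>r\<in>{0..1}. B r \<omega>) (\<Pi>\<^sub>M r\<in>{0..1}. borel)))"
    and "\<And>x. x > 0 \<Longrightarrow> markov_process_from trans_density (P x) X x"
    and "d \<ge> 1"
    and "s 0 = 0" and "\<And>k. k \<in> {0..<d} \<Longrightarrow> s k < s (Suc k)"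
    and "t 0 = 0" and "t 0 \<le> t 1" and "\<And>k. k \<in> {1..<d} \<Longrightarrow> t k < t (Suc k)"
    and "t d \<le> 1" and "t (Suc d) = 1"
  shows "(LINT \<omega>|M. exp (- (\<Sum>k=1..d. (s k - s (k - 1)) * generalized_meander V B (1 - t k) \<omega>)))
       = (LINT x:{0<..}|lborel.
            (LINT \<omega>|P x. exp (- (1 / 2) * (\<Sum>k=0..d. (t (Suc k) - t k) * X (s k) \<omega>)))
              * meander_phi \<nu> x)"
proof (cases "t d < 1")
  case True
  show ?thesis
  proof (rule meander_duality_positive_times[OF assms(1-8)])
    show "t k < t (Suc k)" if "k \<in> {1..d}" for k
      using that assms(14)[of k] True assms(16) by (cases "k = d") auto
  qed (use assms in auto)
next
  case False
  then have t_d: "t d = 1" using assms by simp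
  interpret brownian_excursion M B by fact
  (* The excursion vanishes at time 0 and the weight of the last value of X is t (d + 1) - t d = 0, so
     the time with index d can be left out on both sides. *)
  obtain n where d: "d = Suc n" using \<open>d \<ge> 1\<close> by (cases d) auto
  have "(LINT \<omega>|M. exp (- (\<Sum>k=1..d. (s k - s (k - 1)) * generalized_meander V B (1 - t k) \<omega>)))
      = (LINT \<omega>|M. exp (- (\<Sum>k=1..n. (s k - s (k - 1)) * generalized_meander V B (1 - t k) \<omega>)))"
    using t_d B_0 by (intro Bochner_Integration.integral_cong) (auto simp: d generalized_meander_def)
  also have "\<dots> = (LINT x:{0<..}|lborel.
            (LINT \<omega>|P x. exp (- (1 / 2) * (\<Sum>k=0..n. (t (Suc k) - t k) * X (s k) \<omega>)))
              * meander_phi \<nu> x)"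
    by (rule meander_duality_positive_times[OF assms(1-8)]) (use assms t_d d in auto)
  also have "\<dots> = (LINT x:{0<..}|lborel.
            (LINT \<omega>|P x. exp (- (1 / 2) * (\<Sum>k=0..d. (t (Suc k) - t k) * X (s k) \<omega>)))
              * meander_phi \<nu> x)"
    using t_d assms(16) by (simp add: d)
  finally show ?thesis .
qed

end
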